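(* Let $0<\kappa<1$. Assume the initial data $u_0:\mathbb{R}\to\mathbb{R}$ is bounded, $2\pi$-periodic, odd and non-negative in $[0,\pi]$, and let $u$ be the solution of $$\partial_tu=\kappa^2\partial_{xx}u+u-u^3,\qquad u|_{t=0}=u_0,$$ on the periodic torus $\mathbb{T}=[-\pi,\pi]$. Then, as $t\to\infty$, $u(\cdot,t)$ converges uniformly on $\mathbb T$ either to $U_\kappa$ or to $0$. Moreover, if $u_0\ne0$ and $E_\kappa(u_0)\le\frac\pi2$, then $u(\cdot,t)\to U_\kappa$ as $t\to\infty$ and the rate of convergence is exponential in time.
   Context: The energy is $E_\kappa(u)=\int_{\mathbb{T}}\left(\frac{\kappa^2}{2}|\partial_xu|^2+\frac14(1-u^2)^2\right)dx$ for $2\pi$-periodic $u\in H^1(\mathbb{T})$ (the assumption $E_\kappa(u_0)\le\pi/2$ includes $u_0\in H^1(\mathbb T)$). For $0<\kappa<1$, let $N_\kappa\in(0,1)$ be the unique number with $\int_0^{\pi/2}\frac{d\theta}{\sqrt{2-N_\kappa^2(1+\sin^2\theta)}}=\frac{\pi}{2\sqrt2\,\kappa}$. The odd zero-up ground state $U_\kappa:\mathbb R\to\mathbb R$ is the $2\pi$-periodic odd $C^\infty$ solution of $\kappa^2U_\kappa''+U_\kappa-U_\kappa^3=0$ with $U_\kappa(0)=U_\kappa'(\frac\pi2)=0$, $U_\kappa(\frac\pi2)=N_\kappa$, $U_\kappa$ monotonically increasing on $[0,\frac\pi2]$ and $U_\kappa(\pi-x)=U_\kappa(x)$ for $\frac\pi2\le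 x\le\pi$. The solution for bounded initial data is the unique global bounded (mild) solution, smooth for $t>0$. Exponential convergence means $\sup_x|u(x,t)-U_\kappa(x)|\le Ce^{-ct}$ for all $t\ge 1$ with some constants $C,c>0$ (which may depend on $u_0$ and $\kappa$). *)

theory Defs
  imports "HOL-Analysis.Analysis"
begin

definition periodic_2pi :: "(real \<Rightarrow> real) \<Rightarrow> bool" where
  "periodic_2pi f \<longleftrightarrow> (\<forall>x. f (x + 2 * pi) = f x)"

definition odd_fun :: "(real \<Rightarrow> real) \<Rightarrow> bool" where
  "odd_fun f \<longleftrightarrow> (\<forall>x. f (- x) = - f x)"

(* C^n regularity; meant for open S only, since the derivatives are those at x
   in the whole space. *)
primrec C_n_on :: "nat \<Rightarrow> 'a::real_normed_vector set \<Rightarrow> ('a \<Rightarrow> real) \<Rightarrow> bool" where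
  "C_n_on 0 S f \<longleftrightarrow> continuous_on S f"
| "C_n_on (Suc n) S f \<longleftrightarrow>
     (\<forall>x\<in>S. f differentiable (at x)) \<and>
     (\<forall>v. C_n_on n S (\<lambda>x. frechet_derivative f (at x) v))"

definition C_infinity_on :: "'a::real_normed_vector set \<Rightarrow> ('a \<Rightarrow> real) \<Rightarrow> bool" where
  "C_infinity_on S f \<longleftrightarrow> (\<forall>n. C_n_on n S f)"


(* Elements of L^2(T) are represented by functions on the real line, of which only the
   values on the period cell [-pi, pi] matter, and these only up to null sets. *)
definition L2_torus :: "(real \<Rightarrow> real) \<Rightarrow> bool" where
  "L2_torus f \<longleftrightarrow>
     set_borel_measurable lebesgue {-pi..pi} f \<and>
     set_integrable lebesgue {-pi..pi} (\<lambda>x. (f x)\<^sup>2)"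

definition weak_deriv_torus :: "(real \<Rightarrow> real) \<Rightarrow> (real \<Rightarrow> real) \<Rightarrow> bool" where
  "weak_deriv_torus f g \<longleftrightarrow> L2_torus g \<and>
     (\<forall>\<phi>. C_infinity_on UNIV \<phi> \<and> periodic_2pi \<phi> \<longrightarrow>
        (LINT x:{-pi..pi}|lebesgue. f x * deriv \<phi> x)
          = - (LINT x:{-pi..pi}|lebesgue. g x * \<phi> x))"

definition H1_torus :: "(real \<Rightarrow> real) \<Rightarrow> bool" where
  "H1_torus f \<longleftrightarrow> L2_torus f \<and> (\<exists>g. weak_deriv_torus f g)"

(* The weak derivative is unique up to null sets, so for f in H^1(T) the energy does not
   depend on the representative chosen here.  Outside H^1(T) the value is meaningless. *)
definition torus_deriv :: "(real \<Rightarrow> real) \<Rightarrow> real \<Rightarrow> real" where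
  "torus_deriv f = (SOME g. weak_deriv_torus f g)"

definition energy :: "real \<Rightarrow> (real \<Rightarrow> real) \<Rightarrow> real" where
  "energy \<kappa> f =
     (LINT x:{-pi..pi}|lebesgue.
        \<kappa>\<^sup>2 / 2 * (torus_deriv f x)\<^sup>2 + 1 / 4 * (1 - (f x)\<^sup>2)\<^sup>2)"


definition ground_state_amplitude :: "real \<Rightarrow> real \<Rightarrow> bool" where
  "ground_state_amplitude \<kappa> N \<longleftrightarrow> 0 < N \<and> N < 1 \<and>
     integral {0..pi/2} (\<lambda>\<theta>. 1 / sqrt (2 - N\<^sup>2 * (1 + (sin \<theta>)\<^sup>2)))
       = pi / (2 * sqrt 2 * \<kappa>)"

definition odd_zero_up_ground_state :: "real \<Rightarrow> real \<Rightarrow> (real \<Rightarrow> real) \<Rightarrow> bool" where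
  "odd_zero_up_ground_state \<kappa> N U \<longleftrightarrow>
     periodic_2pi U \<and> odd_fun U \<and> C_infinity_on UNIV U \<and>
     (\<forall>x. \<kappa>\<^sup>2 * deriv (deriv U) x + U x - (U x)^3 = 0) \<and>
     U 0 = 0 \<and> deriv U (pi/2) = 0 \<and> U (pi/2) = N \<and>
     mono_on {0..pi/2} U \<and> (\<forall>x\<in>{pi/2..pi}. U (pi - x) = U x)"


(* Convolution with the Gaussian on the whole line.  On 2 pi-periodic functions this is the
   heat semigroup of the torus: summing the Gaussian over the translates by 2 pi k gives the
   periodic heat kernel. *)
definition heat_semigroup :: "real \<Rightarrow> (real \<Rightarrow> real) \<Rightarrow> real \<Rightarrow> real" where
  "heat_semigroup \<tau> f x =
     (LINT y|lebesgue. exp (- (x - y)\<^sup>2 / (4 * \<tau>)) / sqrt (4 * pi * \<tau>) * f y)"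

(* The global bounded mild solution, which is smooth and solves the equation pointwise for
   t > 0.  The first argument of u is time.  The initial value enters through the Duhamel
   formula; for discontinuous u0 the solution need not be continuous at t = 0. *)
definition allen_cahn_solution ::
    "real \<Rightarrow> (real \<Rightarrow> real) \<Rightarrow> (real \<Rightarrow> real \<Rightarrow> real) \<Rightarrow> bool" where
  "allen_cahn_solution \<kappa> u0 u \<longleftrightarrow>
     u 0 = u0 \<and>
     (\<forall>t\<ge>0. periodic_2pi (u t)) \<and>
     (\<exists>M. \<forall>t\<ge>0. \<forall>x. \<bar>u t x\<bar> \<le> M) \<and>
     C_infinity_on ({0<..} \<times> UNIV) (\<lambda>(t, x). u t x) \<and>
     (\<forall>t>0. \<forall>x. u t x =
        heat_semigroup (\<kappa>\<^sup>2 * t) u0 x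
        + (LINT s:{0<..<t}|lebesgue.
             heat_semigroup (\<kappa>\<^sup>2 * (t - s)) (\<lambda>y. u s y - (u s y)^3) x)) \<and>
     (\<forall>t>0. \<forall>x. deriv (\<lambda>s. u s x) t
        = \<kappa>\<^sup>2 * deriv (deriv (u t)) x + u t x - (u t x)^3)"

end

theory Submission
  imports Defs "HOL-Probability.Distributions"
begin

text \<open>
  On \<open>[0, pi]\<close> the solution is, for \<open>t > 0\<close>, a nonnegative solution with zero boundary values:
  oddness and sign are inherited from the datum by comparison arguments that start at small times
  \<open>e\<close>, when \<open>u(e)\<close> is within \<open>O(e)\<close> of the heat flow of the datum
  (\<open>allen_cahn_near_heat_flow\<close>, \<open>allen_cahn_odd\<close>, \<open>allen_cahn_nonneg\<close>). There are two cases.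

  If \<open>u\<close> vanishes for all \<open>t > 0\<close>, the Duhamel formula shows that all Gaussian averages of the datum
  vanish, and then the datum is zero almost everywhere (\<open>AE_zero_if_heat_semigroup_zero\<close>).

  Otherwise the convergence to \<open>U = U\<^sub>\<kappa>\<close> is exponential. The reason is that for \<open>\<kappa> < 1\<close> the mode
  \<open>sin x\<close> grows like \<open>exp ((1 - \<kappa>\<^sup>2) t)\<close> near the zero state, while \<open>v - v\<^sup>3\<close> is concave for
  \<open>v \<ge> 0\<close>, so that the positive profile \<open>U\<close> is stable and attracts all positive solutions. A quantitative
  form uses explicit barriers only. First, positivity at one point spreads to
  \<open>u(t2, x) \<ge> e sin x\<close> on \<open>[0, pi]\<close> at some later time (\<open>positivity_spreads\<close>), and smoothness with
  the zero boundary values gives \<open>u(t2, x) \<le> A sin x\<close>. Since \<open>U\<close> itself is comparable with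
  \<open>sin x\<close> by concavity (\<open>ground_state_comparable_to_sin\<close>), a subsolution and a supersolution of the
  form \<open>a(t) U(x) + b(t) sin x\<close> fit below and above \<open>u(t2)\<close> (\<open>lower_barrier\<close>,
  \<open>upper_barrier\<close>). In both, \<open>a\<close> tends to \<open>1\<close> and \<open>b\<close> to \<open>0\<close> exponentially fast, and the
  comparison principle \<open>allen_cahn_comparison\<close> squeezes \<open>u\<close> between them.
\<close>

section \<open>The comparison principle\<close>

lemma second_derivative_nonneg_at_local_min:
  fixes f g :: "real \<Rightarrow> real"
  assumes f: "\<And>y. (f has_real_derivative g y) (at y)"
    and g: "(g has_real_derivative D) (at x)"
    and d: "0 < d" and min: "\<And>y. \<bar>x - y\<bar> < d \<Longrightarrow> f x \<le> f y"
  shows "0 \<le> D"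
proof (rule ccontr)
  assume "\<not> 0 \<le> D"
  then have "D < 0" by simp
  have "g x = 0"
    using DERIV_local_min[OF f d] min by blast
  obtain e where e: "e > 0" "\<And>h. 0 < h \<Longrightarrow> h < e \<Longrightarrow> g (x + h) < g x"
    using DERIV_neg_dec_right[OF g \<open>D < 0\<close>] by blast
  define h where "h = min d e / 2"
  have h: "0 < h" "h < d" "h < e"
    using d e(1) by (auto simp: h_def min_def)
  obtain z where z: "x < z" "z < x + h" "f (x + h) - f x = (x + h - x) * g z"
    using MVT2[of x "x + h" f g] f h(1) by auto
  have "g z < 0"
    using e(2)[of "z - x"] z h \<open>g x = 0\<close> by simp
  then have "f (x + h) < f x"
    using z(3) mult_pos_neg[OF h(1) \<open>g z < 0\<close>] by simp
  then show False
    using min[of "x + h"] h by simp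
qed

text \<open>Passing to \<open>exp (- L (t - t0)) * z + m + e (1 + t - t0)\<close> with \<open>e > 0\<close> turns the hypothesis
  into a strict inequality: at a negative space-time minimum of this function the time derivative
  would have to be both nonpositive and at least \<open>e\<close>.\<close>

lemma maximum_principle:
  fixes z :: "real \<Rightarrow> real \<Rightarrow> real"
  assumes K: "compact K" and cont: "continuous_on ({t0..T} \<times> K) (\<lambda>(t, x). z t x)"
    and deriv: "\<And>t x. t0 < t \<Longrightarrow> t \<le> T \<Longrightarrow> x \<in> K \<Longrightarrow> z t x < 0 \<Longrightarrow> (\<And>y. y \<in> K \<Longrightarrow> z t x \<le> z t y)
        \<Longrightarrow> \<exists>D\<ge>L * z t x. ((\<lambda>s. z s x) has_real_derivative D) (at t)"
    and init: "\<And>x. x \<in> K \<Longrightarrow> - m \<le> z t0 x" and m: "0 \<le> m"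
    and t: "t0 \<le> t" "t \<le> T" and x: "x \<in> K"
  shows "- m * exp (L * (t - t0)) \<le> z t x"
proof -
  have strict: "0 \<le> exp (- L * (t - t0)) * z t x + m + e * (1 + (t - t0))" if e: "e > 0" for e
  proof (rule ccontr)
    define Z where "Z = (\<lambda>(s, y). exp (- L * (s - t0)) * z s y + m + e * (1 + (s - t0)))"
    have Z: "Z (s, y) = exp (- L * (s - t0)) * z s y + m + e * (1 + (s - t0))" for s y
      by (simp add: Z_def)
    assume "\<not> ?thesis"
    then have neg: "Z (t, x) < 0" by (simp add: Z)
    have "continuous_on ({t0..T} \<times> K) Z"
      using cont unfolding Z_def split_def by (auto intro!: continuous_intros)
    moreover have "compact ({t0..T} \<times> K)" "{t0..T} \<times> K \<noteq> {}"
      using K t x by (auto intro!: compact_Times)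
    ultimately obtain p where p: "p \<in> {t0..T} \<times> K" "\<And>q. q \<in> {t0..T} \<times> K \<Longrightarrow> Z p \<le> Z q"
      using continuous_attains_inf by metis
    obtain s y where sy: "p = (s, y)" by (cases p)
    have s: "t0 \<le> s" "s \<le> T" and y: "y \<in> K" using p(1) sy by auto
    have Zp: "Z (s, y) < 0"
      using p(2)[of "(t, x)"] t x neg sy by auto
    have "s \<noteq> t0"
    proof
      assume "s = t0"
      then have "Z (s, y) = z t0 y + m + e" by (simp add: Z)
      then show False using init[OF y] Zp e by simp
    qed
    then have s': "t0 < s" using s by simp
    have "0 < e * (1 + (s - t0))" using e s' by simp
    then have "exp (- L * (s - t0)) * z s y < 0"
      using Zp m unfolding Z by linarith
    then have zneg: "z s y < 0" by (simp add: mult_less_0_iff)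
    have "z s y \<le> z s y'" if "y' \<in> K" for y'
    proof -
      have "Z (s, y) \<le> Z (s, y')" using p(2)[of "(s, y')"] s that sy by auto
      then show ?thesis by (simp add: Z)
    qed
    then obtain D where D: "D \<ge> L * z s y" "((\<lambda>s. z s y) has_real_derivative D) (at s)"
      using deriv[OF s' s(2) y zneg] by blast
    define D' where "D' = exp (- L * (s - t0)) * (D - L * z s y) + e"
    have der: "((\<lambda>s. Z (s, y)) has_real_derivative D') (at s)"
      unfolding Z D'_def by (auto intro!: derivative_eq_intros D(2) simp: algebra_simps)
    have "D' > 0"
      using D(1) e by (simp add: D'_def add_nonneg_pos)
    then obtain d where d: "d > 0" "\<And>h. 0 < h \<Longrightarrow> h < d \<Longrightarrow> Z (s - h, y) < Z (s, y)"
      using DERIV_pos_inc_left[OF der] by blast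
    define h where "h = min d (s - t0) / 2"
    have h: "0 < h" "h < d" "h < s - t0"
      using d(1) s' by (auto simp: h_def min_def)
    have "Z p \<le> Z (s - h, y)"
      using h s y by (intro p(2)) auto
    then show False using d(2)[OF h(1,2)] sy by simp
  qed
  have "0 \<le> exp (- L * (t - t0)) * z t x + m"
  proof (rule field_le_epsilon)
    fix e :: real assume "e > 0"
    then show "0 \<le> exp (- L * (t - t0)) * z t x + m + e"
      using strict[of "e / (1 + (t - t0))"] t by simp
  qed
  then have "0 \<le> exp (L * (t - t0)) * (exp (- L * (t - t0)) * z t x + m)"
    by simp
  also have "\<dots> = (exp (L * (t - t0)) * exp (- L * (t - t0))) * z t x + m * exp (L * (t - t0))"
    by (simp only: algebra_simps)
  also have "exp (L * (t - t0)) * exp (- L * (t - t0)) = 1"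
    by (simp flip: exp_add)
  finally show ?thesis by simp
qed

text \<open>The spatial second derivative and the time derivative appear as explicit functions, so that
  differential inequalities for concrete comparison functions are plain arithmetic.\<close>

definition parabolic_derivs ::
    "(real \<Rightarrow> real \<Rightarrow> real) \<Rightarrow> real \<Rightarrow> (real \<Rightarrow> real \<Rightarrow> real) \<Rightarrow> (real \<Rightarrow> real \<Rightarrow> real) \<Rightarrow> bool" where
  "parabolic_derivs v t0 vt vxx \<longleftrightarrow>
     continuous_on ({t0..} \<times> UNIV) (\<lambda>(t, x). v t x) \<and>
     (\<exists>vx. \<forall>t>t0. \<forall>x. ((\<lambda>s. v s x) has_real_derivative vt t x) (at t) \<and>
        (v t has_real_derivative vx t x) (at x) \<and> (vx t has_real_derivative vxx t x) (at x))"

text \<open>Where \<open>w < v\<close> one has \<open>w\<^sup>3 < v\<^sup>3\<close>, so the cubic term has the good sign there and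
  \<open>z = w - v\<close> satisfies \<open>z\<^sub>t \<ge> \<kappa>\<^sup>2 z\<^sub>x\<^sub>x + z\<close>, whatever the size of \<open>v\<close> and \<open>w\<close>.
  The hypothesis \<open>interior\<close> covers both Dirichlet and periodic boundary conditions.\<close>

lemma allen_cahn_comparison:
  fixes v w :: "real \<Rightarrow> real \<Rightarrow> real"
  assumes v: "parabolic_derivs v t0 vt vxx" and w: "parabolic_derivs w t0 wt wxx"
    and K: "compact K"
    and sub: "\<And>t x. t0 < t \<Longrightarrow> x \<in> K \<Longrightarrow> w t x < v t x \<Longrightarrow>
        vt t x \<le> \<kappa>\<^sup>2 * vxx t x + v t x - (v t x)^3"
    and super: "\<And>t x. t0 < t \<Longrightarrow> x \<in> K \<Longrightarrow> w t x < v t x \<Longrightarrow>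
        \<kappa>\<^sup>2 * wxx t x + w t x - (w t x)^3 \<le> wt t x"
    and interior: "\<And>t x. t0 < t \<Longrightarrow> x \<in> K \<Longrightarrow> w t x < v t x \<Longrightarrow>
        (\<And>y. y \<in> K \<Longrightarrow> w t x - v t x \<le> w t y - v t y) \<Longrightarrow>
        \<exists>d>0. \<forall>y. \<bar>x - y\<bar> < d \<longrightarrow> w t x - v t x \<le> w t y - v t y"
    and init: "\<And>x. x \<in> K \<Longrightarrow> v t0 x - m \<le> w t0 x" and m: "0 \<le> m"
    and t: "t0 \<le> t" and x: "x \<in> K"
  shows "v t x - m * exp (t - t0) \<le> w t x"
proof -
  obtain vx where v': "\<And>t x. t0 < t \<Longrightarrow> ((\<lambda>s. v s x) has_real_derivative vt t x) (at t)"
      "\<And>t x. t0 < t \<Longrightarrow> (v t has_real_derivative vx t x) (at x)"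
      "\<And>t x. t0 < t \<Longrightarrow> (vx t has_real_derivative vxx t x) (at x)"
    using v unfolding parabolic_derivs_def by blast
  obtain wx where w': "\<And>t x. t0 < t \<Longrightarrow> ((\<lambda>s. w s x) has_real_derivative wt t x) (at t)"
      "\<And>t x. t0 < t \<Longrightarrow> (w t has_real_derivative wx t x) (at x)"
      "\<And>t x. t0 < t \<Longrightarrow> (wx t has_real_derivative wxx t x) (at x)"
    using w unfolding parabolic_derivs_def by blast
  have "- m * exp (1 * (t - t0)) \<le> w t x - v t x"
  proof (rule maximum_principle[where z = "\<lambda>t x. w t x - v t x" and K = K and T = t])
    have "continuous_on ({t0..t} \<times> K) (\<lambda>(t, x). v t x)"
      "continuous_on ({t0..t} \<times> K) (\<lambda>(t, x). w t x)"
      using v w unfolding parabolic_derivs_def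
      by (auto elim!: continuous_on_subset)
    then show "continuous_on ({t0..t} \<times> K) (\<lambda>(t, x). w t x - v t x)"
      unfolding split_def by (rule continuous_on_diff[rotated])
  next
    fix s y assume s: "t0 < s" and y: "y \<in> K" and neg: "w s y - v s y < 0"
      and min: "\<And>y'. y' \<in> K \<Longrightarrow> w s y - v s y \<le> w s y' - v s y'"
    have lt: "w s y < v s y" using neg by simp
    obtain d where d: "d > 0" "\<And>y'. \<bar>y - y'\<bar> < d \<Longrightarrow> w s y - v s y \<le> w s y' - v s y'"
      using interior[OF s y lt min] by blast
    have "0 \<le> wxx s y - vxx s y"
      by (rule second_derivative_nonneg_at_local_min
          [where f = "\<lambda>x. w s x - v s x" and g = "\<lambda>x. wx s x - vx s x", OF _ _ d])
        (auto intro!: DERIV_diff v' w' s)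
    then have "0 \<le> \<kappa>\<^sup>2 * (wxx s y - vxx s y)" by simp
    moreover have "(w s y)^3 \<le> (v s y)^3"
      using lt by (intro power_mono_odd) auto
    moreover note sub[OF s y lt] super[OF s y lt]
    ultimately have "1 * (w s y - v s y) \<le> wt s y - vt s y"
      by (simp add: algebra_simps)
    then show "\<exists>D\<ge>1 * (w s y - v s y). ((\<lambda>s. w s y - v s y) has_real_derivative D) (at s)"
      using DERIV_diff[OF w'(1)[OF s] v'(1)[OF s]] by blast
  next
    show "- m \<le> w t0 y - v t0 y" if "y \<in> K" for y
      using init[OF that] by simp
  qed (use K m t x in auto)
  then show ?thesis by simp
qed

corollary allen_cahn_comparison_Dirichlet:
  fixes v w :: "real \<Rightarrow> real \<Rightarrow> real"
  assumes v: "parabolic_derivs v t0 vt vxx" and w: "parabolic_derivs w t0 wt wxx"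
    and sub: "\<And>t x. t0 < t \<Longrightarrow> x \<in> {a..b} \<Longrightarrow> w t x < v t x \<Longrightarrow>
        vt t x \<le> \<kappa>\<^sup>2 * vxx t x + v t x - (v t x)^3"
    and super: "\<And>t x. t0 < t \<Longrightarrow> x \<in> {a..b} \<Longrightarrow> w t x < v t x \<Longrightarrow>
        \<kappa>\<^sup>2 * wxx t x + w t x - (w t x)^3 \<le> wt t x"
    and boundary: "\<And>t. t0 < t \<Longrightarrow> v t a \<le> w t a" "\<And>t. t0 < t \<Longrightarrow> v t b \<le> w t b"
    and init: "\<And>x. x \<in> {a..b} \<Longrightarrow> v t0 x - m \<le> w t0 x" and m: "0 \<le> m"
    and t: "t0 \<le> t" and x: "x \<in> {a..b}"
  shows "v t x - m * exp (t - t0) \<le> w t x"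
proof (rule allen_cahn_comparison[OF v w compact_Icc sub super _ init m t x])
  fix s y assume s: "t0 < s" and y: "y \<in> {a..b}" and lt: "w s y < v s y"
    and min: "\<And>y'. y' \<in> {a..b} \<Longrightarrow> w s y - v s y \<le> w s y' - v s y'"
  have "y \<noteq> a" "y \<noteq> b" using boundary[OF s] lt by auto
  then have "min (y - a) (b - y) > 0" using y by auto
  moreover have "\<forall>y'. \<bar>y - y'\<bar> < min (y - a) (b - y) \<longrightarrow> w s y - v s y \<le> w s y' - v s y'"
    by (auto intro!: min simp: abs_if split: if_splits)
  ultimately show "\<exists>d>0. \<forall>y'. \<bar>y - y'\<bar> < d \<longrightarrow> w s y - v s y \<le> w s y' - v s y'"
    by blast
qed auto

corollary allen_cahn_comparison_periodic:
  fixes v w :: "real \<Rightarrow> real \<Rightarrow> real"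
  assumes v: "parabolic_derivs v t0 vt vxx" and w: "parabolic_derivs w t0 wt wxx"
    and sub: "\<And>t x. t0 < t \<Longrightarrow> vt t x \<le> \<kappa>\<^sup>2 * vxx t x + v t x - (v t x)^3"
    and super: "\<And>t x. t0 < t \<Longrightarrow> \<kappa>\<^sup>2 * wxx t x + w t x - (w t x)^3 \<le> wt t x"
    and periodic: "\<And>t. t0 < t \<Longrightarrow> periodic_2pi (v t)" "\<And>t. t0 < t \<Longrightarrow> periodic_2pi (w t)"
    and init: "\<And>x. v t0 x - m \<le> w t0 x" and m: "0 \<le> m"
    and t: "t0 \<le> t" and x: "x \<in> {-pi..pi}"
  shows "v t x - m * exp (t - t0) \<le> w t x"
proof (rule allen_cahn_comparison[OF v w compact_Icc sub super _ init m t x])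
  fix s y assume s: "t0 < s" and y: "y \<in> {-pi..pi}"
    and min: "\<And>y'. y' \<in> {-pi..pi} \<Longrightarrow> w s y - v s y \<le> w s y' - v s y'"
  have "w s y - v s y \<le> w s y' - v s y'" if y': "\<bar>y - y'\<bar> < pi" for y'
  proof -
    note per = periodic[OF s, unfolded periodic_2pi_def]
    consider "y' \<in> {-pi..pi}" | "y' + 2 * pi \<in> {-pi..pi}" | "y' - 2 * pi \<in> {-pi..pi}"
      using y y' by fastforce
    then show ?thesis
    proof cases
      case 2
      then show ?thesis using min[OF 2] per by simp
    next
      case 3
      then show ?thesis
        using min[OF 3] per(1)[rule_format, of "y' - 2 * pi"] per(2)[rule_format, of "y' - 2 * pi"]
        by simp
    qed (rule min)
  qed
  then show "\<exists>d>0. \<forall>y'. \<bar>y - y'\<bar> < d \<longrightarrow> w s y - v s y \<le> w s y' - v s y'"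
    using pi_gt_zero by blast
qed auto

section \<open>Regularity\<close>

lemma partial_derivative_fst:
  fixes F :: "real \<times> real \<Rightarrow> real"
  assumes "F differentiable (at (t, x))"
  shows "((\<lambda>s. F (s, x)) has_real_derivative frechet_derivative F (at (t, x)) (1, 0)) (at t)"
proof -
  let ?D = "frechet_derivative F (at (t, x))"
  have F: "(F has_derivative ?D) (at (t, x))"
    using assms by (simp add: frechet_derivative_works)
  have "((\<lambda>s. (s, x)) has_derivative (\<lambda>h. (h, 0))) (at t)"
    by (auto intro!: derivative_eq_intros)
  then have "((\<lambda>s. F (s, x)) has_derivative (\<lambda>h. ?D (h, 0))) (at t)"
    using has_derivative_compose[of "\<lambda>s. (s, x)" _ t UNIV F ?D] F by simp
  moreover have "(\<lambda>h. ?D (h, 0)) = (*) (?D (1, 0))"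
  proof
    fix h show "?D (h, 0) = ?D (1, 0) * h"
      using linear_cmul[OF has_derivative_linear[OF F], of h "(1, 0)"] by simp
  qed
  ultimately show ?thesis by (simp only: has_field_derivative_def)
qed

lemma partial_derivative_snd:
  fixes F :: "real \<times> real \<Rightarrow> real"
  assumes "F differentiable (at (t, x))"
  shows "((\<lambda>y. F (t, y)) has_real_derivative frechet_derivative F (at (t, x)) (0, 1)) (at x)"
proof -
  let ?D = "frechet_derivative F (at (t, x))"
  have F: "(F has_derivative ?D) (at (t, x))"
    using assms by (simp add: frechet_derivative_works)
  have "((\<lambda>y. (t, y)) has_derivative (\<lambda>h. (0, h))) (at x)"
    by (auto intro!: derivative_eq_intros)
  then have "((\<lambda>y. F (t, y)) has_derivative (\<lambda>h. ?D (0, h))) (at x)"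
    using has_derivative_compose[of "\<lambda>y. (t, y)" _ x UNIV F ?D] F by simp
  moreover have "(\<lambda>h. ?D (0, h)) = (*) (?D (0, 1))"
  proof
    fix h show "?D (0, h) = ?D (0, 1) * h"
      using linear_cmul[OF has_derivative_linear[OF F], of h "(0, 1)"] by simp
  qed
  ultimately show ?thesis by (simp only: has_field_derivative_def)
qed

lemma C_infinity_on_UNIV_derivs:
  fixes f :: "real \<Rightarrow> real"
  assumes "C_infinity_on UNIV f"
  shows "(f has_real_derivative deriv f x) (at x)"
    and "(deriv f has_real_derivative deriv (deriv f) x) (at x)"
proof -
  have 2: "C_n_on (Suc (Suc 0)) UNIV f"
    using assms[unfolded C_infinity_on_def, THEN spec] .
  have f: "f differentiable (at x)" for x
    using 2[unfolded C_n_on.simps, THEN conjunct1, THEN bspec, OF UNIV_I] .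
  then show "(f has_real_derivative deriv f x) (at x)"
    by (simp add: DERIV_deriv_iff_real_differentiable)
  have "deriv f = (\<lambda>x. frechet_derivative f (at x) 1)"
  proof
    fix x
    have D: "(f has_derivative frechet_derivative f (at x)) (at x)"
      using f[of x] by (simp add: frechet_derivative_works)
    have "frechet_derivative f (at x) h = frechet_derivative f (at x) 1 * h" for h
      using linear_cmul[OF has_derivative_linear[OF D], of h 1] by simp
    then have "frechet_derivative f (at x) = (*) (frechet_derivative f (at x) 1)"
      by (rule ext)
    with D have "(f has_real_derivative frechet_derivative f (at x) 1) (at x)"
      unfolding has_field_derivative_def by metis
    then show "deriv f x = frechet_derivative f (at x) 1"
      by (rule DERIV_imp_deriv)
  qed
  then have "deriv f differentiable (at x)"
    using 2[unfolded C_n_on.simps, THEN conjunct2, THEN spec, THEN conjunct1, THEN bspec, OF UNIV_I]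
    by (simp only:)
  then show "(deriv f has_real_derivative deriv (deriv f) x) (at x)"
    by (simp add: DERIV_deriv_iff_real_differentiable)
qed

lemma allen_cahn_solution_derivs:
  assumes "allen_cahn_solution \<kappa> u0 u" and t: "0 < t"
  shows "(u t has_real_derivative deriv (u t) x) (at x)"
    and "(deriv (u t) has_real_derivative deriv (deriv (u t)) x) (at x)"
    and "((\<lambda>s. u s x) has_real_derivative
      \<kappa>\<^sup>2 * deriv (deriv (u t)) x + u t x - (u t x)^3) (at t)"
proof -
  let ?F = "\<lambda>(t, x). u t x" and ?S = "{0<..} \<times> UNIV :: (real \<times> real) set"
  have "C_infinity_on ?S ?F"
    using assms(1) by (simp only: allen_cahn_solution_def)
  then have 2: "C_n_on (Suc (Suc 0)) ?S ?F"
    by (rule C_infinity_on_def[THEN iffD1, THEN spec])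
  have tx: "(t, x) \<in> ?S" for x using t by simp
  have F: "?F differentiable (at (t, x))" for x
    using 2[unfolded C_n_on.simps, THEN conjunct1, THEN bspec, OF tx] .
  have F': "(\<lambda>z. frechet_derivative ?F (at z) (0, 1)) differentiable (at (t, x))" for x
    using 2[unfolded C_n_on.simps, THEN conjunct2, THEN spec, THEN conjunct1, THEN bspec, OF tx] .
  have ux: "(u t has_real_derivative frechet_derivative ?F (at (t, x)) (0, 1)) (at x)" for x
    using partial_derivative_snd[OF F] by simp
  then have d: "deriv (u t) = (\<lambda>x. frechet_derivative ?F (at (t, x)) (0, 1))"
    by (auto intro!: ext DERIV_imp_deriv)
  show "(u t has_real_derivative deriv (u t) x) (at x)"
    using ux d by simp
  show "(deriv (u t) has_real_derivative deriv (deriv (u t)) x) (at x)"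
    using DERIV_deriv_iff_has_field_derivative partial_derivative_snd[OF F'[of x]]
    unfolding d by blast
  have "((\<lambda>s. u s x) has_real_derivative deriv (\<lambda>s. u s x) t) (at t)"
    using DERIV_deriv_iff_has_field_derivative partial_derivative_fst[OF F[of x]] by force
  moreover have "deriv (\<lambda>s. u s x) t = \<kappa>\<^sup>2 * deriv (deriv (u t)) x + u t x - (u t x)^3"
    using assms unfolding allen_cahn_solution_def by blast
  ultimately show "((\<lambda>s. u s x) has_real_derivative
      \<kappa>\<^sup>2 * deriv (deriv (u t)) x + u t x - (u t x)^3) (at t)"
    by simp
qed

lemma allen_cahn_solution_parabolic_derivs:
  assumes u: "allen_cahn_solution \<kappa> u0 u" and t0: "0 < t0"
  shows "parabolic_derivs u t0
    (\<lambda>t x. \<kappa>\<^sup>2 * deriv (deriv (u t)) x + u t x - (u t x)^3) (\<lambda>t x. deriv (deriv (u t)) x)"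
proof -
  have "C_infinity_on ({0<..} \<times> UNIV) (\<lambda>(t, x). u t x)"
    using u by (simp only: allen_cahn_solution_def)
  then have "C_n_on 0 ({0<..} \<times> UNIV) (\<lambda>(t, x). u t x)"
    by (rule C_infinity_on_def[THEN iffD1, THEN spec])
  then have "continuous_on ({t0..} \<times> UNIV) (\<lambda>(t, x). u t x)"
    using t0 by (auto elim!: continuous_on_subset)
  then show ?thesis
    unfolding parabolic_derivs_def
    using allen_cahn_solution_derivs[OF u] t0
    by (intro conjI exI[of _ "\<lambda>t. deriv (u t)"]) auto
qed

section \<open>Comparison with the sine\<close>

lemma concave_above_chord:
  fixes f :: "real \<Rightarrow> real"
  assumes f: "\<And>x. (f has_real_derivative f' x) (at x)"
    and f': "\<And>x. (f' has_real_derivative f'' x) (at x)"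
    and neg: "\<And>x. x \<in> {0..a} \<Longrightarrow> f'' x \<le> 0" and f0: "f 0 = 0"
    and x: "0 \<le> x" "x \<le> a" and a: "0 < a"
  shows "x / a * f a \<le> f x"
proof -
  have "concave_on {0..a} f"
    by (rule f''_le0_imp_concave[where f' = f' and f'' = f'']) (use f f' neg in auto)
  from concave_onD_Icc[OF this, of "x / a"] show ?thesis
    using x a f0 by simp
qed

lemma Jordan_sin_bound:
  assumes "0 \<le> x" "x \<le> pi / 2"
  shows "x \<le> pi / 2 * sin x"
proof -
  have "x / (pi / 2) * sin (pi / 2) \<le> sin x"
    by (rule concave_above_chord[where f' = cos and f'' = "\<lambda>x. - sin x"])
      (use assms in \<open>auto intro!: derivative_eq_intros sin_ge_zero\<close>)
  then show ?thesis by (simp add: field_simps)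
qed

lemma abs_le_sin_if_zero_at_ends:
  fixes f :: "real \<Rightarrow> real"
  assumes f: "\<And>x. (f has_real_derivative f' x) (at x)"
    and f': "continuous_on {0..pi} f'" and f0: "f 0 = 0" "f pi = 0"
  obtains A where "0 < A" "\<And>x. x \<in> {0..pi} \<Longrightarrow> \<bar>f x\<bar> \<le> A * sin x"
proof -
  obtain L where L: "0 < L" "\<And>x. x \<in> {0..pi} \<Longrightarrow> \<bar>f' x\<bar> \<le> L"
    using compact_imp_bounded[OF compact_continuous_image[OF f' compact_Icc]]
    unfolding bounded_pos by auto
  have lip: "\<bar>f x - f y\<bar> \<le> L * \<bar>x - y\<bar>" if "x \<in> {0..pi}" "y \<in> {0..pi}" for x y
    using field_differentiable_bound[of "{0..pi}" f f' L y x] L that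
      has_field_derivative_at_within[OF f]
    by (simp add: abs_minus_commute)
  have "\<bar>f x\<bar> \<le> L * pi / 2 * sin x" if x: "x \<in> {0..pi}" for x
  proof (cases "x \<le> pi / 2")
    case True
    then have "L * x \<le> L * (pi / 2 * sin x)"
      using x L by (intro mult_left_mono Jordan_sin_bound) auto
    then show ?thesis using lip[of x 0] x f0 by simp
  next
    case False
    then have "L * (pi - x) \<le> L * (pi / 2 * sin (pi - x))"
      using x L by (intro mult_left_mono Jordan_sin_bound) auto
    then show ?thesis using lip[of x pi] x f0 by simp
  qed
  moreover have "0 < L * pi / 2" using L by simp
  ultimately show ?thesis using that by blast
qed

text \<open>On \<open>[0, pi/2]\<close> the profile takes values in \<open>[0, 1]\<close>, so the equation makes it concave there
  and it lies above its chord.\<close>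

lemma ground_state_comparable_to_sin:
  assumes "0 < \<kappa>" and N: "0 < N" "N < 1" and U: "odd_zero_up_ground_state \<kappa> N U"
  obtains k K where "0 < k" "0 < K"
    "\<And>x. x \<in> {0..pi} \<Longrightarrow> sin x \<le> k * U x" "\<And>x. x \<in> {0..pi} \<Longrightarrow> U x \<le> K * sin x"
proof -
  have smooth: "C_infinity_on UNIV U" and ode: "\<kappa>\<^sup>2 * deriv (deriv U) x + U x - (U x)^3 = 0"
    and U0: "U 0 = 0" and UN: "U (pi/2) = N" and mono: "mono_on {0..pi/2} U"
    and refl: "x \<in> {pi/2..pi} \<Longrightarrow> U (pi - x) = U x" for x
    using U unfolding odd_zero_up_ground_state_def by auto
  note dU = C_infinity_on_UNIV_derivs[OF smooth]
  have Upi: "U pi = 0" using refl[of pi] U0 by simp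
  obtain K where K: "0 < K" "\<And>x. x \<in> {0..pi} \<Longrightarrow> \<bar>U x\<bar> \<le> K * sin x"
    using abs_le_sin_if_zero_at_ends[OF dU(1) _ U0 Upi] dU(2)
    by (metis DERIV_continuous_on has_field_derivative_at_within)
  have concave: "deriv (deriv U) x \<le> 0" if "x \<in> {0..pi/2}" for x
  proof -
    have "0 \<le> U x" "U x \<le> 1"
      using mono_onD[OF mono, of 0 x] mono_onD[OF mono, of x "pi/2"] that U0 UN N by auto
    then have "(U x)^3 \<le> U x"
      using power_decreasing[of 1 3 "U x"] by simp
    then have "\<kappa>\<^sup>2 * deriv (deriv U) x \<le> 0" using ode[of x] by simp
    then show ?thesis using \<open>0 < \<kappa>\<close> by (simp add: mult_le_0_iff)
  qed
  define k where "k = pi / (2 * N)"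
  have half: "sin x \<le> k * U x" if x: "x \<in> {0..pi/2}" for x
  proof -
    have "x / (pi/2) * U (pi/2) \<le> U x"
      by (rule concave_above_chord[OF dU concave U0]) (use x in auto)
    then have "x \<le> k * U x" using UN N by (simp add: k_def field_simps)
    then show ?thesis using sin_x_le_x[of x] x by simp
  qed
  have "sin x \<le> k * U x" if x: "x \<in> {0..pi}" for x
    using half[of x] half[of "pi - x"] refl[of x] x by (cases "x \<le> pi/2") auto
  moreover have "U x \<le> K * sin x" if "x \<in> {0..pi}" for x
    using K(2)[OF that] by simp
  moreover have "0 < k" using N by (simp add: k_def)
  ultimately show ?thesis using that K(1) by blast
qed

section \<open>Positivity spreads over the whole interval\<close>

text \<open>With \<open>y = cos x\<close> and \<open>v = u / sin x\<close> the operator \<open>u \<mapsto> u\<^sub>x\<^sub>x\<close> becomes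
  \<open>(1 - y\<^sup>2) v\<^sub>y\<^sub>y - 3 y v\<^sub>y - v\<close> on \<open>[-1, 1]\<close>, whose drift points inwards at both ends, so a bump
  spreading with time stays a subsolution, where it is positive, even after its front has reached
  an end. The
  bump is the cube of \<open>q = R - (y - y1)\<^sup>2\<close>, where \<open>R\<close> grows linearly in time. Near the front,
  where \<open>q\<close> is small and \<open>1 - y\<^sup>2\<close> may be small as well, the choice of the speed \<open>P\<close> makes the
  terms linear in \<open>q\<close> cancel; what remains is \<open>(q - \<rho>)\<^sup>2 \<ge> 0\<close>, because of the choice of \<open>\<alpha>\<close>.\<close>

lemma bump_inequality:
  fixes c y1 q R \<rho> \<kappa> :: real
  assumes q: "0 < q" and \<rho>: "0 < \<rho>" "\<rho> \<le> R" and rho: "(c - y1)\<^sup>2 = R - q"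
    and c: "\<bar>c\<bar> \<le> 1" and P: "P = 6 * \<kappa>\<^sup>2 * (1 - \<bar>y1\<bar>)" and \<alpha>: "\<alpha> = \<kappa>\<^sup>2 + 24 * \<kappa>\<^sup>2 / \<rho>"
  shows "- \<alpha> * q^3 + 3 * P * q\<^sup>2 \<le>
    \<kappa>\<^sup>2 * (- (q^3) + 18 * c * (c - y1) * q\<^sup>2 - 6 * (1 - c\<^sup>2) * q\<^sup>2 + 24 * (1 - c\<^sup>2) * (c - y1)\<^sup>2 * q)"
proof -
  define s where "s = 1 - c\<^sup>2"
  have s: "0 \<le> s" "s \<le> 1"
    using c by (auto simp: s_def abs_square_le_1)
  have "c * y1 \<le> \<bar>y1\<bar>"
    using mult_right_mono[OF c abs_ge_zero[of y1]] by (simp add: abs_mult[symmetric])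
  then have drift: "0 \<le> 18 * (\<bar>y1\<bar> - c * y1) * q"
    using q by simp
  have "0 \<le> (q - \<rho>)\<^sup>2 / \<rho>" using \<rho> by simp
  also have "\<dots> = q\<^sup>2 / \<rho> - 2 * q + \<rho>"
    using \<rho> by (simp add: power2_eq_square field_simps)
  also have "\<dots> \<le> q\<^sup>2 / \<rho> - 2 * q + R" using \<rho> by simp
  finally have "0 \<le> s * (q\<^sup>2 / \<rho> - 2 * q + R)" using s by simp
  moreover have "s * (q\<^sup>2 / \<rho>) \<le> 1 * (q\<^sup>2 / \<rho>)"
    using s \<rho> by (intro mult_right_mono) auto
  ultimately have square: "0 \<le> 24 * (q\<^sup>2 / \<rho> + s * (R - 2 * q))"
    by argo
  have "\<kappa>\<^sup>2 * (- (q^3) + 18 * c * (c - y1) * q\<^sup>2 - 6 * (1 - c\<^sup>2) * q\<^sup>2 + 24 * (1 - c\<^sup>2) * (c - y1)\<^sup>2 * q)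
      - (- \<alpha> * q^3 + 3 * P * q\<^sup>2)
    = \<kappa>\<^sup>2 * q * (24 * (q\<^sup>2 / \<rho> + s * (R - 2 * q)) + 18 * (\<bar>y1\<bar> - c * y1) * q)"
    unfolding P \<alpha> rho using \<rho>
    by (simp add: s_def field_simps power2_eq_square power3_eq_cube)
  also have "\<dots> \<ge> 0"
    by (rule mult_nonneg_nonneg[OF _ add_nonneg_nonneg[OF square drift]]) (use q in simp)
  finally show ?thesis by simp
qed

lemma positivity_spreads:
  fixes u :: "real \<Rightarrow> real \<Rightarrow> real"
  assumes \<kappa>: "0 < \<kappa>" and u: "parabolic_derivs u t1 ut uxx"
    and super: "\<And>t x. t1 < t \<Longrightarrow> x \<in> {0..pi} \<Longrightarrow> \<kappa>\<^sup>2 * uxx t x + u t x - (u t x)^3 \<le> ut t x"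
    and nonneg: "\<And>t x. t1 \<le> t \<Longrightarrow> x \<in> {0..pi} \<Longrightarrow> 0 \<le> u t x"
    and x1: "0 < x1" "x1 < pi" and pos: "0 < u t1 x1"
  obtains t2 e where "t1 \<le> t2" "0 < e" "\<And>x. x \<in> {0..pi} \<Longrightarrow> e * sin x \<le> u t2 x"
proof -
  define y1 where "y1 = cos x1"
  define \<mu> where "\<mu> = u t1 x1 / 2"
  have \<mu>: "0 < \<mu>" using pos by (simp add: \<mu>_def)
  have y1: "\<bar>y1\<bar> < 1"
    using x1 cos_monotone_0_pi[of 0 x1] cos_monotone_0_pi[of x1 pi] by (simp add: y1_def abs_less_iff)
  obtain r where r: "0 < r" "\<And>x. x \<in> {0..pi} \<Longrightarrow> \<bar>cos x - y1\<bar> < r \<Longrightarrow> \<mu> \<le> u t1 x"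
  proof -
    have cu: "continuous_on ({t1..} \<times> UNIV) (\<lambda>(t, x). u t x)"
      using u by (simp add: parabolic_derivs_def)
    have "continuous_on {-1..1} (\<lambda>y. (t1, arccos y))"
      by (auto intro!: continuous_intros)
    from continuous_on_compose2[OF cu this]
    have "continuous_on {-1..1} (\<lambda>y. u t1 (arccos y))" by auto
    moreover have "u t1 (arccos y1) = u t1 x1"
      using x1 by (simp add: y1_def arccos_cos)
    moreover have "y1 \<in> {-1..1}" using y1 by auto
    ultimately obtain r where "0 < r" and
      r0: "\<And>y. y \<in> {-1..1} \<Longrightarrow> dist y y1 < r \<Longrightarrow> dist (u t1 (arccos y)) (u t1 x1) < \<mu>"
      using \<mu> unfolding continuous_on_iff by metis
    have "\<mu> \<le> u t1 x" if x: "x \<in> {0..pi}" "\<bar>cos x - y1\<bar> < r" for x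
    proof -
      have "dist (u t1 (arccos (cos x))) (u t1 x1) < \<mu>"
        using x by (intro r0) (auto simp: dist_real_def)
      then show ?thesis
        using x by (simp add: dist_real_def arccos_cos \<mu>_def abs_if split: if_splits)
    qed
    then show ?thesis using \<open>0 < r\<close> that by blast
  qed
  define P where "P = 6 * \<kappa>\<^sup>2 * (1 - \<bar>y1\<bar>)"
  define \<alpha> where "\<alpha> = \<kappa>\<^sup>2 + 24 * \<kappa>\<^sup>2 / r\<^sup>2"
  \<comment> \<open>The bump has to start below \<open>\<mu>\<close>, and it has to stay below \<open>1\<close>, so that \<open>W - W\<^sup>3 \<ge> 0\<close> and the
    heat operator alone decides.\<close>
  define m where "m = min \<mu> 1 / r^6"
  define R where "R t = r\<^sup>2 + P * (t - t1)" for t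
  define q where "q t x = R t - (cos x - y1)\<^sup>2" for t x
  define E where "E t = m * exp (- \<alpha> * (t - t1))" for t
  define W where "W t x = E t * (sin x * q t x ^ 3)" for t x
  define Wt where "Wt t x = E t * (sin x * (- \<alpha> * q t x ^ 3 + 3 * P * (q t x)\<^sup>2))" for t x
  define Wx where "Wx t x = E t * (cos x * q t x ^ 3 + 6 * (sin x)\<^sup>2 * (cos x - y1) * (q t x)\<^sup>2)"
    for t x
  define Wxx where "Wxx t x = E t * (sin x * (- (q t x ^ 3) + 18 * cos x * (cos x - y1) * (q t x)\<^sup>2
      - 6 * (1 - (cos x)\<^sup>2) * (q t x)\<^sup>2 + 24 * (1 - (cos x)\<^sup>2) * (cos x - y1)\<^sup>2 * q t x))" for t x
  have P: "0 < P" using \<kappa> y1 by (simp add: P_def)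
  have m: "0 < m" "m * r^6 \<le> \<mu>" "m * r^6 \<le> 1" using \<mu> r(1) by (auto simp: m_def)
  have E: "0 < E t" for t using m by (simp add: E_def)
  have qx: "((\<lambda>x. q t x) has_real_derivative 2 * (cos x - y1) * sin x) (at x)" for t x
    unfolding q_def by (auto intro!: derivative_eq_intros)
  have qt: "((\<lambda>t. q t x) has_real_derivative P) (at t)" for t x
    unfolding q_def R_def by (auto intro!: derivative_eq_intros)
  have Et: "(E has_real_derivative - \<alpha> * E t) (at t)" for t
    unfolding E_def by (auto intro!: derivative_eq_intros)
  have W: "parabolic_derivs W t1 Wt Wxx"
    unfolding parabolic_derivs_def
  proof (intro conjI exI[of _ Wx] allI impI)
    show "continuous_on ({t1..} \<times> UNIV) (\<lambda>(t, x). W t x)"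
      unfolding W_def E_def q_def R_def split_def by (intro continuous_intros)
    fix t x
    show "((\<lambda>s. W s x) has_real_derivative Wt t x) (at t)"
      unfolding W_def Wt_def
      by (auto intro!: derivative_eq_intros Et qt simp: algebra_simps power2_eq_square power3_eq_cube)
    show "(W t has_real_derivative Wx t x) (at x)"
      unfolding W_def Wx_def
      by (auto intro!: derivative_eq_intros qx simp: algebra_simps power2_eq_square)
    have eq: "E t * (- sin x * q t x ^ 3
        + cos x * (3 * (q t x)\<^sup>2 * (2 * (cos x - y1) * sin x))
        + (12 * sin x * cos x * (cos x - y1) * (q t x)\<^sup>2 - 6 * (sin x)\<^sup>2 * sin x * (q t x)\<^sup>2
        + 6 * (sin x)\<^sup>2 * (cos x - y1) * (2 * q t x * (2 * (cos x - y1) * sin x)))) = Wxx t x"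
      unfolding Wxx_def sin_squared_eq[symmetric] by (simp add: algebra_simps power2_eq_square)
    show "(Wx t has_real_derivative Wxx t x) (at x)"
      unfolding Wx_def eq[symmetric]
      by (auto intro!: derivative_eq_intros qx simp: algebra_simps power2_eq_square)
  qed
  have R: "r\<^sup>2 \<le> R t" if "t1 \<le> t" for t
    using P that by (simp add: R_def)
  have W1: "W t x \<le> 1" if t: "t1 \<le> t" and x: "x \<in> {0..pi}" and q: "0 < q t x" for t x
  proof -
    have "R t = r\<^sup>2 * (1 + P / r\<^sup>2 * (t - t1))"
      using r(1) by (simp add: R_def field_simps)
    also have "\<dots> \<le> r\<^sup>2 * exp (P / r\<^sup>2 * (t - t1))"
      by (intro mult_left_mono exp_ge_add_one_self) auto
    finally have "R t \<le> r\<^sup>2 * exp (P / r\<^sup>2 * (t - t1))" .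
    then have "q t x ^ 3 \<le> (r\<^sup>2 * exp (P / r\<^sup>2 * (t - t1)))^3"
      using q by (intro power_mono) (auto simp: q_def intro: order_trans[rotated])
    also have "\<dots> = r^6 * exp (3 * P / r\<^sup>2 * (t - t1))"
      by (simp add: power_mult_distrib flip: exp_of_nat_mult power_mult)
    also have "\<dots> \<le> r^6 * exp (\<alpha> * (t - t1))"
    proof -
      have "3 * P \<le> 24 * \<kappa>\<^sup>2"
        using mult_left_mono[of "1 - \<bar>y1\<bar>" 1 "\<kappa>\<^sup>2"] zero_le_power2[of \<kappa>] unfolding P_def by linarith
      then have "3 * P / r\<^sup>2 \<le> \<alpha>"
        using divide_right_mono[of "3 * P" "24 * \<kappa>\<^sup>2" "r\<^sup>2"] by (simp add: \<alpha>_def add_increasing)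
      then show ?thesis
        using mult_right_mono[of "3 * P / r\<^sup>2" \<alpha> "t - t1"] t by (intro mult_left_mono) auto
    qed
    finally have q3: "q t x ^ 3 \<le> r^6 * exp (\<alpha> * (t - t1))" .
    have "sin x * q t x ^ 3 \<le> 1 * q t x ^ 3"
      using q by (intro mult_right_mono) auto
    then have "W t x \<le> E t * (r^6 * exp (\<alpha> * (t - t1)))"
      unfolding W_def using q3 E[of t] by (intro mult_left_mono) auto
    also have "\<dots> = m * r^6"
      by (simp add: E_def flip: exp_add)
    finally show ?thesis using m by simp
  qed
  have below: "W t x - 0 * exp (t - t1) \<le> u t x" if "t1 \<le> t" "x \<in> {0..pi}" for t x
  proof (rule allen_cahn_comparison_Dirichlet[OF W u, where a = 0 and b = pi and \<kappa> = \<kappa>])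
    fix t x assume t: "t1 < t" and x: "x \<in> {0..pi}" and lt: "u t x < W t x"
    show "\<kappa>\<^sup>2 * uxx t x + u t x - (u t x)^3 \<le> ut t x"
      by (rule super[OF t x])
    have "0 < W t x" using nonneg[of t x] t x lt by simp
    moreover have s: "0 \<le> sin x" using x by (auto intro: sin_ge_zero)
    ultimately have q: "0 < q t x"
      using E[of t] by (auto simp: W_def zero_less_mult_iff zero_less_power_eq)
    have "W t x ^ 3 \<le> W t x"
      using power_decreasing[of 1 3 "W t x"] W1[OF less_imp_le[OF t] x q] \<open>0 < W t x\<close> by simp
    moreover have "Wt t x \<le> \<kappa>\<^sup>2 * Wxx t x"
    proof -
      have "- \<alpha> * q t x ^ 3 + 3 * P * (q t x)\<^sup>2 \<le> \<kappa>\<^sup>2 * (- (q t x ^ 3)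
          + 18 * cos x * (cos x - y1) * (q t x)\<^sup>2 - 6 * (1 - (cos x)\<^sup>2) * (q t x)\<^sup>2
          + 24 * (1 - (cos x)\<^sup>2) * (cos x - y1)\<^sup>2 * q t x)"
        by (rule bump_inequality[where R = "R t" and \<rho> = "r\<^sup>2"])
          (use q r(1) R t P_def \<alpha>_def in \<open>auto simp: q_def\<close>)
      then have "E t * (sin x * (- \<alpha> * q t x ^ 3 + 3 * P * (q t x)\<^sup>2)) \<le>
          E t * (sin x * (\<kappa>\<^sup>2 * (- (q t x ^ 3)
          + 18 * cos x * (cos x - y1) * (q t x)\<^sup>2 - 6 * (1 - (cos x)\<^sup>2) * (q t x)\<^sup>2
          + 24 * (1 - (cos x)\<^sup>2) * (cos x - y1)\<^sup>2 * q t x)))"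
        using s E[of t] by (intro mult_left_mono) auto
      then show ?thesis
        unfolding Wt_def Wxx_def by (simp only: mult.left_commute[of "\<kappa>\<^sup>2"])
    qed
    ultimately show "Wt t x \<le> \<kappa>\<^sup>2 * Wxx t x + W t x - (W t x)^3" by simp
  next
    fix t :: real assume "t1 < t"
    then show "W t 0 \<le> u t 0" "W t pi \<le> u t pi"
      using nonneg[of t 0] nonneg[of t pi] by (auto simp: W_def)
  next
    fix x assume x: "x \<in> {0..pi}"
    have s: "0 \<le> sin x" using x by (auto intro: sin_ge_zero)
    show "W t1 x - 0 \<le> u t1 x"
    proof (cases "\<bar>cos x - y1\<bar> < r")
      case True
      then have "(cos x - y1)\<^sup>2 < r\<^sup>2" using r(1) by (metis abs_le_square_iff abs_of_pos not_le)
      then have "0 \<le> q t1 x" "q t1 x \<le> r\<^sup>2" by (auto simp: q_def R_def)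
      then have "sin x * q t1 x ^ 3 \<le> 1 * (r\<^sup>2) ^ 3"
        using s by (intro mult_mono power_mono) auto
      then have "m * (sin x * q t1 x ^ 3) \<le> m * r^6"
        using m(1) by (intro mult_left_mono) (auto simp flip: power_mult)
      from order_trans[OF order_trans[OF this m(2)] r(2)[OF x True]] show ?thesis
        by (simp add: W_def E_def)
    next
      case False
      then have "r\<^sup>2 \<le> (cos x - y1)\<^sup>2"
        using r(1) by (metis abs_le_square_iff abs_of_pos not_less)
      then have "q t1 x ^ 3 \<le> 0" by (simp add: q_def R_def power_le_zero_eq)
      then have "W t1 x \<le> 0"
        using s m(1) by (simp add: W_def E_def mult_nonneg_nonpos)
      then show ?thesis using nonneg[of t1 x] x by simp
    qed
  qed (use that in auto)
  \<comment> \<open>At time \<open>t2\<close> the radius is so large that \<open>q \<ge> 1\<close> on all of \<open>[-1, 1]\<close>.\<close>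
  define t2 where "t2 = t1 + 5 / P"
  have t2: "t1 \<le> t2" using P by (simp add: t2_def)
  have "E t2 * sin x \<le> u t2 x" if x: "x \<in> {0..pi}" for x
  proof -
    have "\<bar>cos x - y1\<bar> \<le> 2"
      using y1 cos_ge_minus_one[of x] cos_le_one[of x] by linarith
    then have "(cos x - y1)\<^sup>2 \<le> 4" using abs_le_square_iff[of "cos x - y1" 2] by simp
    moreover have "R t2 = r\<^sup>2 + 5" using P by (simp add: R_def t2_def)
    ultimately have "1 \<le> q t2 x"
      using zero_le_power2[of r] unfolding q_def by linarith
    then have "1 \<le> q t2 x ^ 3" by (rule one_le_power)
    then have "sin x * 1 \<le> sin x * q t2 x ^ 3"
      using x by (intro mult_left_mono sin_ge_zero) auto
    then have "E t2 * sin x \<le> W t2 x"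
      unfolding W_def using E[of t2] by (intro mult_left_mono) auto
    then show ?thesis using below[OF t2 x] by simp
  qed
  then show ?thesis using that[OF t2 E] by blast
qed

section \<open>Barriers around a positive stationary profile\<close>

lemma cubic_factor_le_one:
  fixes y :: real
  assumes "0 \<le> y" "y \<le> 1"
  shows "y\<^sup>2 * ((3 - y) / 2)^3 \<le> 1"
proof -
  define z where "z = (3 - y) / 2"
  have y: "y = 3 - 2 * z" by (simp add: z_def field_simps)
  have z: "1 \<le> z" "2 * z \<le> 3" using assms by (auto simp: z_def)
  have "0 \<le> (z - 1) * (2 * z - 1)" using z by simp
  then have 1: "y * z \<le> 1" unfolding y by (simp add: algebra_simps)
  have "0 \<le> (z - 1)\<^sup>2 * (2 * z + 1)" using z by simp
  then have 2: "y * z * z \<le> 1" unfolding y by (simp add: algebra_simps power2_eq_square)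
  have "(y * z) * (y * z * z) \<le> 1 * 1"
    using 1 2 assms z by (intro mult_mono) auto
  then show ?thesis by (simp add: power2_eq_square power3_eq_cube mult_ac flip: z_def)
qed

text \<open>The two comparisons with \<open>sin x\<close> are the only quantitative information on the profile that the
  barriers use.\<close>

locale stationary_profile =
  fixes \<kappa> k K :: real and U :: "real \<Rightarrow> real"
  assumes \<kappa>: "0 < \<kappa>" "\<kappa> < 1"
    and dU: "(U has_real_derivative deriv U x) (at x)"
    and ddU: "(deriv U has_real_derivative deriv (deriv U) x) (at x)"
    and ode: "\<kappa>\<^sup>2 * deriv (deriv U) x + U x - (U x)^3 = 0"
    and U_ends: "U 0 = 0" "U pi = 0"
    and k: "0 < k" and K: "0 < K"
    and sin_le: "x \<in> {0..pi} \<Longrightarrow> sin x \<le> k * U x"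
    and le_sin: "x \<in> {0..pi} \<Longrightarrow> U x \<le> K * sin x"
begin

lemma U_nonneg: "x \<in> {0..pi} \<Longrightarrow> 0 \<le> U x"
  using sin_le[of x] k sin_ge_zero[of x] by (auto simp: zero_le_mult_iff dest: order_trans)

lemma one_minus_kappa: "0 < 1 - \<kappa>\<^sup>2"
  using \<kappa> by (simp add: abs_square_less_1)

text \<open>All barriers are combinations \<open>a(t) U(x) + b(t) sin x\<close>. A multiple \<open>a U\<close> alone has residual
  \<open>(a\<^sup>3 - a) U\<^sup>3\<close>, which vanishes to third order at the ends of the interval and therefore leaves no
  room for \<open>a\<close> to move; the term \<open>(1 - \<kappa>\<^sup>2) b sin x\<close> that the unstable mode \<open>sin x\<close> of the zero
  state contributes vanishes only to first order.\<close>

lemma barrier_derivs: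
  assumes a: "\<And>t. (a has_real_derivative a' t) (at t)"
    and b: "\<And>t. (b has_real_derivative b' t) (at t)"
  shows "parabolic_derivs (\<lambda>t x. a t * U x + b t * sin x) t0
    (\<lambda>t x. a' t * U x + b' t * sin x) (\<lambda>t x. a t * deriv (deriv U) x - b t * sin x)"
  unfolding parabolic_derivs_def
proof (intro conjI exI[of _ "\<lambda>t x. a t * deriv U x + b t * cos x"] allI impI)
  have ca: "continuous_on UNIV a" and cb: "continuous_on UNIV b" and cU: "continuous_on UNIV U"
    using a b dU by (blast intro: DERIV_continuous_on has_field_derivative_at_within)+
  have "continuous_on S (\<lambda>p. a (fst p))" "continuous_on S (\<lambda>p. b (fst p))"
    "continuous_on S (\<lambda>p. U (snd p))" for S :: "(real \<times> real) set"
    by (rule continuous_on_compose2[OF ca] continuous_on_compose2[OF cb] continuous_on_compose2[OF cU];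
        auto intro!: continuous_intros)+
  then show "continuous_on ({t0..} \<times> UNIV) (\<lambda>(t, x). a t * U x + b t * sin x)"
    unfolding split_def
    by (intro continuous_on_add continuous_on_mult continuous_on_sin continuous_on_snd continuous_on_id)
qed (auto intro!: derivative_eq_intros a b dU ddU)

lemma barrier_spatial_part:
  "\<kappa>\<^sup>2 * (a * deriv (deriv U) x - b * sin x) + (a * U x + b * sin x)
    = a * (U x)^3 + (1 - \<kappa>\<^sup>2) * b * sin x"
proof -
  have "\<kappa>\<^sup>2 * deriv (deriv U) x = (U x)^3 - U x" using ode[of x] by simp
  then have "a * (\<kappa>\<^sup>2 * deriv (deriv U) x) = a * ((U x)^3 - U x)" by simp
  then show ?thesis by (simp add: algebra_simps)
qed

text \<open>Here \<open>a\<close> solves the logistic equation and \<open>b = a (1 - a) / (2 k)\<close> is positive as long as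
  \<open>a\<close> still has to grow. Since \<open>a + k b = a (3 - a) / 2\<close>, the cubic term costs at most
  \<open>a\<^sup>3 ((3 - a) / 2)\<^sup>3 U\<^sup>3 \<le> a U\<^sup>3\<close>.\<close>

lemma lower_barrier:
  fixes u :: "real \<Rightarrow> real \<Rightarrow> real"
  assumes u: "parabolic_derivs u t0 ut uxx"
    and super: "\<And>t x. t0 < t \<Longrightarrow> x \<in> {0..pi} \<Longrightarrow> \<kappa>\<^sup>2 * uxx t x + u t x - (u t x)^3 \<le> ut t x"
    and ends: "\<And>t. t0 < t \<Longrightarrow> 0 \<le> u t 0" "\<And>t. t0 < t \<Longrightarrow> 0 \<le> u t pi"
    and e: "0 < e" "\<And>x. x \<in> {0..pi} \<Longrightarrow> e * sin x \<le> u t0 x"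
  obtains B \<nu> where "0 < B" "0 < \<nu>"
    "\<And>t x. t0 \<le> t \<Longrightarrow> x \<in> {0..pi} \<Longrightarrow> (1 - B * exp (- \<nu> * (t - t0))) * U x \<le> u t x"
proof -
  define \<nu> where "\<nu> = (1 - \<kappa>\<^sup>2) / (3 * k * K)"
  \<comment> \<open>With this \<open>B\<close> the barrier starts below \<open>e sin x\<close>: at \<open>t0\<close> it is at most
    \<open>a (K + 1 / (2 k)) sin x\<close> with \<open>a = 1 / (1 + B)\<close>.\<close>
  define B where "B = (K + 1 / (2 * k)) / e"
  define a where "a t = 1 / (1 + B * exp (- \<nu> * (t - t0)))" for t
  define b where "b t = a t * (1 - a t) / (2 * k)" for t
  define a' where "a' t = \<nu> * a t * (1 - a t)" for t
  define b' where "b' t = a' t * (1 - 2 * a t) / (2 * k)" for t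
  have \<nu>: "0 < \<nu>" using one_minus_kappa k K by (simp add: \<nu>_def)
  have B: "0 < B" using k K e by (simp add: B_def add_pos_pos)
  have den: "0 < 1 + B * exp (- \<nu> * (t - t0))" for t
    using B by (simp add: add_pos_pos)
  have a01: "0 < a t" "a t < 1" for t
    using den[of t] B by (auto simp: a_def)
  have da: "(a has_real_derivative a' t) (at t)" for t
  proof -
    have eq: "\<nu> * (B * exp (- \<nu> * (t - t0))) / (1 + B * exp (- \<nu> * (t - t0)))\<^sup>2 = a' t"
      unfolding a'_def a_def using den[of t] by (simp add: divide_simps power2_eq_square)
    show ?thesis
      unfolding eq[symmetric] unfolding a_def using den[of t]
      by (auto intro!: derivative_eq_intros simp: power2_eq_square)
  qed
  have db: "(b has_real_derivative b' t) (at t)" for t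
    unfolding b_def b'_def using k
    by (auto intro!: derivative_eq_intros da simp: field_simps)
  let ?v = "\<lambda>t x. a t * U x + b t * sin x"
  have below: "?v t x - 0 * exp (t - t0) \<le> u t x" if "t0 \<le> t" "x \<in> {0..pi}" for t x
  proof (rule allen_cahn_comparison_Dirichlet[OF barrier_derivs[OF da db] u,
        where a = 0 and b = pi and \<kappa> = \<kappa>])
    fix t x assume t: "t0 < t" and x: "x \<in> {0..pi}"
    have s: "0 \<le> sin x" using x by (auto intro: sin_ge_zero)
    note U = U_nonneg[OF x]
    have b0: "0 \<le> b t" using a01[of t] k by (simp add: b_def)
    have cubic: "(a t * U x + b t * sin x)^3 \<le> a t * (U x)^3"
    proof -
      have "a t * U x + b t * sin x \<le> a t * U x + b t * (k * U x)"
        using b0 sin_le[OF x] by (intro add_left_mono mult_left_mono) auto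
      also have "\<dots> = a t * ((3 - a t) / 2) * U x"
        using k by (simp add: b_def field_simps)
      finally have "(a t * U x + b t * sin x)^3 \<le> (a t * ((3 - a t) / 2) * U x)^3"
        using a01[of t] b0 U s by (intro power_mono) auto
      also have "\<dots> = (a t)\<^sup>2 * ((3 - a t) / 2)^3 * (a t * (U x)^3)"
        by (simp add: power_mult_distrib power2_eq_square power3_eq_cube)
      also have "\<dots> \<le> 1 * (a t * (U x)^3)"
      proof (rule mult_right_mono)
        show "(a t)\<^sup>2 * ((3 - a t) / 2)^3 \<le> 1"
          using a01[of t] by (intro cubic_factor_le_one) auto
      qed (use a01[of t] U in auto)
      finally show ?thesis by simp
    qed
    have growth: "a' t * U x + b' t * sin x \<le> (1 - \<kappa>\<^sup>2) * b t * sin x"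
    proof -
      have a'0: "0 \<le> a' t" using \<nu> a01[of t] by (simp add: a'_def)
      have "b' t * sin x \<le> a' t / (2 * k) * sin x"
        unfolding b'_def using a'0 a01[of t] k s
        by (intro mult_right_mono divide_right_mono) (auto intro!: mult_left_le)
      also have "\<dots> \<le> a' t / (2 * k) * (k * U x)"
        using sin_le[OF x] a'0 k by (intro mult_left_mono) auto
      also have "\<dots> = a' t * U x / 2" using k by simp
      finally have "a' t * U x + b' t * sin x \<le> 3 / 2 * a' t * U x"
        by (simp add: mult.commute)
      also have "\<dots> \<le> 3 / 2 * a' t * (K * sin x)"
        using le_sin[OF x] a'0 by (intro mult_left_mono) auto
      also have "\<dots> = (3 / 2 * \<nu> * K) * (a t * (1 - a t)) * sin x"
        by (simp add: a'_def)
      also have "3 / 2 * \<nu> * K = (1 - \<kappa>\<^sup>2) / (2 * k)"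
        using k K by (simp add: \<nu>_def field_simps)
      also have "(1 - \<kappa>\<^sup>2) / (2 * k) * (a t * (1 - a t)) * sin x = (1 - \<kappa>\<^sup>2) * b t * sin x"
        by (simp add: b_def)
      finally show ?thesis .
    qed
    show "a' t * U x + b' t * sin x \<le> \<kappa>\<^sup>2 * (a t * deriv (deriv U) x - b t * sin x)
        + (a t * U x + b t * sin x) - (a t * U x + b t * sin x)^3"
      unfolding barrier_spatial_part using cubic growth by simp
    show "\<kappa>\<^sup>2 * uxx t x + u t x - (u t x)^3 \<le> ut t x"
      by (rule super[OF t x])
  next
    fix x assume x: "x \<in> {0..pi}"
    have s: "0 \<le> sin x" using x by (auto intro: sin_ge_zero)
    have a0: "a t0 = 1 / (1 + B)" by (simp add: a_def)
    have "b t0 \<le> a t0 / (2 * k)"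
      unfolding b_def using a01[of t0] k by (intro divide_right_mono mult_left_le) auto
    then have "a t0 * U x + b t0 * sin x \<le> a t0 * (K * sin x) + a t0 / (2 * k) * sin x"
      using le_sin[OF x] a01[of t0] s by (intro add_mono mult_left_mono mult_right_mono) auto
    also have "\<dots> = (a t0 * (K + 1 / (2 * k))) * sin x"
      by (simp add: distrib_left distrib_right)
    also have "\<dots> \<le> e * sin x"
    proof (rule mult_right_mono[OF _ s])
      have eq: "K + 1 / (2 * k) = B * e" using e by (simp add: B_def)
      have "B * e \<le> e * (1 + B)" using e by (simp add: distrib_left)
      then show "a t0 * (K + 1 / (2 * k)) \<le> e"
        unfolding a0 eq using B by (simp add: divide_le_eq)
    qed
    also have "\<dots> \<le> u t0 x" by (rule e(2)[OF x])
    finally show "a t0 * U x + b t0 * sin x - 0 \<le> u t0 x" by simp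
  qed (use ends U_ends that in auto)
  have "(1 - B * exp (- \<nu> * (t - t0))) * U x \<le> u t x" if t: "t0 \<le> t" and x: "x \<in> {0..pi}" for t x
  proof -
    have "(1 - X) * (1 + X) \<le> 1" for X :: real
      by (simp add: algebra_simps)
    then have "1 - B * exp (- \<nu> * (t - t0)) \<le> a t"
      unfolding a_def by (subst pos_le_divide_eq[OF den])
    then have "(1 - B * exp (- \<nu> * (t - t0))) * U x \<le> a t * U x"
      using U_nonneg[OF x] by (rule mult_right_mono)
    moreover have "0 \<le> b t * sin x"
      using a01[of t] k x by (intro mult_nonneg_nonneg) (auto simp: b_def intro: sin_ge_zero)
    ultimately show ?thesis using below[OF t x] by simp
  qed
  then show ?thesis using that B \<nu> by blast
qed

text \<open>The function \<open>\<psi> = U - \<eta> sin x\<close> is nonnegative and satisfies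
  \<open>\<kappa>\<^sup>2 \<psi>\<^sub>x\<^sub>x + \<psi> - 3 U\<^sup>2 \<psi> \<le> - c \<psi>\<close>: away from the ends because of the term \<open>- 2 U\<^sup>3\<close> that
  \<open>U\<close> contributes, near the ends because of the instability of the mode \<open>sin x\<close>. As the
  nonlinearity is concave above \<open>U\<close>, \<open>U + D \<psi>\<close> remains a supersolution for arbitrarily large \<open>D\<close>
  decaying at the rate \<open>c\<close>.\<close>

lemma upper_barrier:
  fixes u :: "real \<Rightarrow> real \<Rightarrow> real"
  assumes u: "parabolic_derivs u t0 ut uxx"
    and sub: "\<And>t x. t0 < t \<Longrightarrow> x \<in> {0..pi} \<Longrightarrow> ut t x \<le> \<kappa>\<^sup>2 * uxx t x + u t x - (u t x)^3"
    and ends: "\<And>t. t0 < t \<Longrightarrow> u t 0 \<le> 0" "\<And>t. t0 < t \<Longrightarrow> u t pi \<le> 0"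
    and A: "0 < A" "\<And>x. x \<in> {0..pi} \<Longrightarrow> u t0 x \<le> A * sin x"
  obtains B c where "0 < B" "0 < c"
    "\<And>t x. t0 \<le> t \<Longrightarrow> x \<in> {0..pi} \<Longrightarrow> u t x \<le> (1 + B * exp (- c * (t - t0))) * U x"
proof -
  \<comment> \<open>The largest \<open>\<eta>\<close> for which \<open>sin x \<le> k U\<close> yields \<open>3 \<eta> sin x \<le> 2 U\<close>, that is,
    \<open>U - \<eta> sin x \<ge> U / 3\<close>.\<close>
  define \<eta> where "\<eta> = 2 / (3 * k)"
  define c where "c = \<eta> * (1 - \<kappa>\<^sup>2) / K"
  define B where "B = 3 * k * A"
  define D where "D t = B * exp (- c * (t - t0))" for t
  have \<eta>: "0 < \<eta>" using k by (simp add: \<eta>_def)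
  have c: "0 < c" using \<eta> one_minus_kappa K by (simp add: c_def)
  have B: "0 < B" using A k by (simp add: B_def)
  have D: "0 < D t" for t using B by (simp add: D_def)
  have da: "((\<lambda>t. 1 + D t) has_real_derivative - c * D t) (at t)" for t
    unfolding D_def by (auto intro!: derivative_eq_intros)
  have db: "((\<lambda>t. - \<eta> * D t) has_real_derivative \<eta> * c * D t) (at t)" for t
    unfolding D_def by (auto intro!: derivative_eq_intros)
  have \<psi>: "U x / 3 \<le> U x - \<eta> * sin x" if "x \<in> {0..pi}" for x
    using mult_left_mono[OF sin_le[OF that] less_imp_le[OF \<eta>]] k by (simp add: \<eta>_def)
  let ?w = "\<lambda>t x. (1 + D t) * U x + - \<eta> * D t * sin x"
  have above: "u t x - 0 * exp (t - t0) \<le> ?w t x" if "t0 \<le> t" "x \<in> {0..pi}" for t x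
  proof (rule allen_cahn_comparison_Dirichlet[OF u barrier_derivs[OF da db],
        where a = 0 and b = pi and \<kappa> = \<kappa>])
    fix t x assume t: "t0 < t" and x: "x \<in> {0..pi}"
    have s: "0 \<le> sin x" using x by (auto intro: sin_ge_zero)
    note U = U_nonneg[OF x]
    have cubic: "(1 + D t) * (U x)^3 \<le> ((1 + D t) * U x + - \<eta> * D t * sin x)^3"
    proof -
      have "1 + D t \<le> (1 + D t / 3)^3"
        using Bernoulli_inequality[of "D t / 3" 3] D[of t] by simp
      then have "(1 + D t) * (U x)^3 \<le> (1 + D t / 3)^3 * (U x)^3"
        using U by (intro mult_right_mono) auto
      also have "\<dots> = ((1 + D t / 3) * U x)^3"
        by (simp add: power_mult_distrib)
      also have "\<dots> \<le> ((1 + D t) * U x + - \<eta> * D t * sin x)^3"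
      proof (rule power_mono)
        have "D t * (U x / 3) \<le> D t * (U x - \<eta> * sin x)"
          using \<psi>[OF x] D[of t] by (intro mult_left_mono) auto
        then show "(1 + D t / 3) * U x \<le> (1 + D t) * U x + - \<eta> * D t * sin x"
          by (simp add: algebra_simps)
      qed (use U D[of t] in auto)
      finally show ?thesis .
    qed
    have decay: "(1 - \<kappa>\<^sup>2) * (- \<eta> * D t) * sin x \<le> - c * D t * U x + \<eta> * c * D t * sin x"
    proof -
      have "c * U x \<le> c * (K * sin x)"
        using le_sin[OF x] c by (intro mult_left_mono) auto
      also have "\<dots> = \<eta> * (1 - \<kappa>\<^sup>2) * sin x"
        using K by (simp add: c_def)
      also have "\<dots> \<le> \<eta> * (1 - \<kappa>\<^sup>2) * sin x + \<eta> * c * sin x"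
        using \<eta> c s by simp
      finally have "D t * (c * U x) \<le> D t * (\<eta> * (1 - \<kappa>\<^sup>2) * sin x + \<eta> * c * sin x)"
        using D[of t] by (intro mult_left_mono) auto
      then show ?thesis by (simp add: algebra_simps)
    qed
    show "\<kappa>\<^sup>2 * ((1 + D t) * deriv (deriv U) x - - \<eta> * D t * sin x)
        + ((1 + D t) * U x + - \<eta> * D t * sin x) - ((1 + D t) * U x + - \<eta> * D t * sin x)^3
        \<le> - c * D t * U x + \<eta> * c * D t * sin x"
      unfolding barrier_spatial_part using cubic decay by simp
    show "ut t x \<le> \<kappa>\<^sup>2 * uxx t x + u t x - (u t x)^3"
      by (rule sub[OF t x])
  next
    fix x assume x: "x \<in> {0..pi}"
    have "A * sin x \<le> A * (k * U x)"
      using sin_le[OF x] A by (intro mult_left_mono) auto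
    also have "\<dots> = B * (U x / 3)" by (simp add: B_def)
    also have "\<dots> \<le> B * (U x - \<eta> * sin x)"
      using \<psi>[OF x] B by (intro mult_left_mono) auto
    also have "\<dots> \<le> (1 + B) * U x + - \<eta> * B * sin x"
      using U_nonneg[OF x] by (simp add: algebra_simps)
    finally show "u t0 x - 0 \<le> (1 + D t0) * U x + - \<eta> * D t0 * sin x"
      using A(2)[OF x] by (simp add: D_def)
  qed (use ends U_ends that in auto)
  have "u t x \<le> (1 + B * exp (- c * (t - t0))) * U x" if t: "t0 \<le> t" and x: "x \<in> {0..pi}" for t x
  proof -
    have "0 \<le> \<eta> * D t * sin x"
      using \<eta> D[of t] x by (intro mult_nonneg_nonneg) (auto intro: sin_ge_zero)
    then show ?thesis using above[OF t x] by (simp add: D_def)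
  qed
  then show ?thesis using that B c by blast
qed

end

section \<open>The heat semigroup for small times\<close>

lemma abs_integral_le:
  fixes f g :: "'a \<Rightarrow> real"
  assumes "integrable M g" and "\<And>x. \<bar>f x\<bar> \<le> g x"
  shows "\<bar>integral\<^sup>L M f\<bar> \<le> integral\<^sup>L M g"
proof (cases "integrable M f")
  case True
  have "\<bar>integral\<^sup>L M f\<bar> \<le> (LINT x|M. \<bar>f x\<bar>)" by (rule integral_abs_bound)
  also have "\<dots> \<le> integral\<^sup>L M g"
    using True assms by (intro integral_mono) auto
  finally show ?thesis .
next
  case False
  have "0 \<le> integral\<^sup>L M g"
    using assms(2) by (intro Bochner_Integration.integral_nonneg) (meson abs_ge_zero order_trans)
  then show ?thesis using False by (simp add: not_integrable_integral_eq)
qed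

lemma heat_semigroup_normal_density:
  assumes "0 < \<tau>"
  shows "heat_semigroup \<tau> f x = (LINT y|lebesgue. normal_density x (sqrt (2 * \<tau>)) y * f y)"
  using assms unfolding heat_semigroup_def normal_density_def
  by (simp add: power2_commute[of x])

lemma integrable_normal_density_lebesgue:
  "0 < \<sigma> \<Longrightarrow> integrable lebesgue (normal_density \<mu> \<sigma>)"
  by (subst integrable_completion) auto

lemma integral_normal_density_lebesgue:
  "0 < \<sigma> \<Longrightarrow> integral\<^sup>L lebesgue (normal_density \<mu> \<sigma>) = 1"
  by (subst integral_completion) auto

lemma normal_second_moment_lebesgue:
  assumes "0 < \<sigma>"
  shows "integrable lebesgue (\<lambda>y. normal_density \<mu> \<sigma> y * (y - \<mu>)\<^sup>2)"
    and "integral\<^sup>L lebesgue (\<lambda>y. normal_density \<mu> \<sigma> y * (y - \<mu>)\<^sup>2) = \<sigma>\<^sup>2"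
proof -
  have meas: "(\<lambda>y. normal_density \<mu> \<sigma> y * (y - \<mu>)\<^sup>2) \<in> borel_measurable lborel" by measurable
  show "integrable lebesgue (\<lambda>y. normal_density \<mu> \<sigma> y * (y - \<mu>)\<^sup>2)"
    using integrable_normal_moment[OF assms, of \<mu> 2] integrable_completion[OF meas] by simp
  show "integral\<^sup>L lebesgue (\<lambda>y. normal_density \<mu> \<sigma> y * (y - \<mu>)\<^sup>2) = \<sigma>\<^sup>2"
    using integral_normal_moment_even[OF assms, of \<mu> 1] integral_completion[OF meas] by simp
qed

lemma integrable_normal_density_mult:
  assumes "0 < \<sigma>" and "f \<in> borel_measurable lebesgue" and "\<And>x. \<bar>f x\<bar> \<le> C"
  shows "integrable lebesgue (\<lambda>y. normal_density \<mu> \<sigma> y * f y)"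
proof (rule Bochner_Integration.integrable_bound)
  show "integrable lebesgue (\<lambda>y. C * normal_density \<mu> \<sigma> y)"
    using integrable_normal_density_lebesgue[OF assms(1)] by simp
  show "(\<lambda>y. normal_density \<mu> \<sigma> y * f y) \<in> borel_measurable lebesgue"
    using borel_measurable_integrable[OF integrable_normal_density_lebesgue[OF assms(1)]] assms(2)
    by simp
  show "AE y in lebesgue. norm (normal_density \<mu> \<sigma> y * f y) \<le> norm (C * normal_density \<mu> \<sigma> y)"
  proof (rule AE_I2)
    fix y
    have "\<bar>f y\<bar> \<le> \<bar>C\<bar>" using assms(3)[of y] by simp
    then show "norm (normal_density \<mu> \<sigma> y * f y) \<le> norm (C * normal_density \<mu> \<sigma> y)"
      using mult_right_mono[of "\<bar>f y\<bar>" "\<bar>C\<bar>" "normal_density \<mu> \<sigma> y"]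
      by (simp add: abs_mult mult.commute)
  qed
qed

lemma heat_semigroup_bound:
  assumes \<tau>: "0 < \<tau>" and "\<And>x. \<bar>f x\<bar> \<le> C"
  shows "\<bar>heat_semigroup \<tau> f x\<bar> \<le> C"
proof -
  have \<sigma>: "0 < sqrt (2 * \<tau>)" using \<tau> by simp
  have "\<bar>LINT y|lebesgue. normal_density x (sqrt (2 * \<tau>)) y * f y\<bar>
      \<le> (LINT y|lebesgue. C * normal_density x (sqrt (2 * \<tau>)) y)"
  proof (rule abs_integral_le)
    show "\<bar>normal_density x (sqrt (2 * \<tau>)) y * f y\<bar> \<le> C * normal_density x (sqrt (2 * \<tau>)) y" for y
      using mult_right_mono[OF assms(2)[of y] normal_density_nonneg]
      by (simp add: abs_mult mult.commute)
  qed (simp add: integrable_normal_density_lebesgue[OF \<sigma>])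
  then show ?thesis
    by (simp add: heat_semigroup_normal_density[OF \<tau>] integral_normal_density_lebesgue[OF \<sigma>])
qed

lemma heat_semigroup_reflect:
  "heat_semigroup \<tau> f x = heat_semigroup \<tau> (\<lambda>y. f (c - y)) (c - x)"
  unfolding heat_semigroup_def
  by (subst lebesgue_integral_real_affine[where c = "-1" and t = c])
    (simp_all add: power2_eq_square algebra_simps)

lemma heat_semigroup_odd:
  assumes "odd_fun f"
  shows "heat_semigroup \<tau> f (- x) = - heat_semigroup \<tau> f x"
proof -
  have "heat_semigroup \<tau> f (- x) = heat_semigroup \<tau> (\<lambda>y. - f y) x"
    using heat_semigroup_reflect[of \<tau> f "- x" 0] assms by (simp add: odd_fun_def)
  then show ?thesis by (simp add: heat_semigroup_def)
qed

lemma odd_fun_reflect_pi: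
  assumes "odd_fun f" "periodic_2pi f"
  shows "f (pi - (- y)) = - f (pi - y)"
proof -
  have "f (pi - (- y)) = f (- (pi - y) + 2 * pi)" by (simp add: algebra_simps)
  also have "\<dots> = - f (pi - y)" using assms unfolding odd_fun_def periodic_2pi_def by metis
  finally show ?thesis .
qed

text \<open>For odd periodic data the semigroup in fact preserves nonnegativity on \<open>[0, pi]\<close>, but a
  lower bound of order \<open>\<tau>\<close> is elementary and suffices. The reflected kernel
  \<open>G(x - y) - G(x + y)\<close> has the sign of \<open>y\<close>, so the part \<open>\<bar>y\<bar> \<le> pi\<close> contributes nonnegatively;
  for \<open>x \<le> pi/2\<close> the remaining \<open>y\<close> are at distance at least \<open>pi/2\<close> from \<open>x\<close> and \<open>- x\<close>, and
  Chebyshev's inequality bounds their mass. The other half \<open>x \<ge> pi/2\<close> follows by reflecting the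
  interval at its midpoint.\<close>

lemma heat_semigroup_lower_bound_left:
  assumes \<tau>: "0 < \<tau>" and f: "f \<in> borel_measurable lebesgue" "\<And>x. \<bar>f x\<bar> \<le> C"
    and odd: "odd_fun f" and nonneg: "\<And>x. x \<in> {0..pi} \<Longrightarrow> 0 \<le> f x"
    and x: "x \<in> {0..pi/2}"
  shows "- (C * 8 / pi\<^sup>2 * \<tau>) \<le> heat_semigroup \<tau> f x"
proof -
  define \<sigma> where "\<sigma> = sqrt (2 * \<tau>)"
  have \<sigma>: "0 < \<sigma>" "\<sigma>\<^sup>2 = 2 * \<tau>" using \<tau> by (auto simp: \<sigma>_def)
  have C: "0 \<le> C" using f(2)[of 0] by linarith
  let ?G = "\<lambda>m y. normal_density m \<sigma> y"
  let ?T = "\<lambda>m y. ?G m y * (y - m)\<^sup>2"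
  have int: "integrable lebesgue (\<lambda>y. ?G m y * f y)" for m
    by (rule integrable_normal_density_mult[OF \<sigma>(1) f])
  have "2 * heat_semigroup \<tau> f x = heat_semigroup \<tau> f x - heat_semigroup \<tau> f (- x)"
    using heat_semigroup_odd[OF odd] by simp
  also have "\<dots> = (LINT y|lebesgue. ?G x y * f y - ?G (- x) y * f y)"
    using int by (simp add: heat_semigroup_normal_density[OF \<tau>] \<sigma>_def)
  also have "\<dots> \<ge> (LINT y|lebesgue. - (4 * C / pi\<^sup>2) * (?T x y + ?T (- x) y))"
  proof (rule integral_mono)
    fix y
    show "- (4 * C / pi\<^sup>2) * (?T x y + ?T (- x) y) \<le> ?G x y * f y - ?G (- x) y * f y"
    proof (cases "\<bar>y\<bar> \<le> pi")
      case True
      have mono: "?G m y \<le> ?G m' y" if "(y - m')\<^sup>2 \<le> (y - m)\<^sup>2" for m m'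
        unfolding normal_density_def using that
        by (intro mult_left_mono) (auto intro!: divide_right_mono)
      have "0 \<le> (?G x y - ?G (- x) y) * f y"
      proof (cases "0 \<le> y")
        case True
        then have "(y - x)\<^sup>2 \<le> (y - (- x))\<^sup>2"
          using x by (intro abs_le_square_iff[THEN iffD1]) auto
        then show ?thesis
          using mono nonneg[of y] True \<open>\<bar>y\<bar> \<le> pi\<close> by (intro mult_nonneg_nonneg) auto
      next
        case False
        then have "(y - (- x))\<^sup>2 \<le> (y - x)\<^sup>2"
          using x by (intro abs_le_square_iff[THEN iffD1]) auto
        moreover have "f y \<le> 0"
          using nonneg[of "- y"] False \<open>\<bar>y\<bar> \<le> pi\<close> odd by (simp add: odd_fun_def)
        ultimately show ?thesis
          using mono by (intro mult_nonpos_nonpos) auto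
      qed
      moreover have "0 \<le> (4 * C / pi\<^sup>2) * (?T x y + ?T (- x) y)"
        using C by simp
      ultimately show ?thesis by (simp add: algebra_simps)
    next
      case False
      have tail: "?G m y * \<bar>f y\<bar> \<le> (4 * C / pi\<^sup>2) * ?T m y" if "m = x \<or> m = - x" for m
      proof -
        have "pi / 2 \<le> \<bar>y - m\<bar>" using False x that by (auto simp: abs_if split: if_splits)
        then have "(pi / 2)\<^sup>2 \<le> (y - m)\<^sup>2" using abs_le_square_iff[of "pi / 2" "y - m"] by simp
        then have "1 \<le> 4 / pi\<^sup>2 * (y - m)\<^sup>2"
          by (simp add: field_simps power2_eq_square)
        then have "C * 1 \<le> C * (4 / pi\<^sup>2 * (y - m)\<^sup>2)"
          using C by (rule mult_left_mono)
        then have "\<bar>f y\<bar> \<le> C * (4 / pi\<^sup>2 * (y - m)\<^sup>2)" using f(2)[of y] by simp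
        from mult_left_mono[OF this normal_density_nonneg] show ?thesis
          by (simp add: mult_ac)
      qed
      have "- (?G x y * \<bar>f y\<bar> + ?G (- x) y * \<bar>f y\<bar>) \<le> ?G x y * f y - ?G (- x) y * f y"
        using mult_left_mono[of "- \<bar>f y\<bar>" "f y" "?G x y"]
          mult_left_mono[of "f y" "\<bar>f y\<bar>" "?G (- x) y"]
          abs_ge_minus_self[of "f y"] abs_ge_self[of "f y"] by simp
      moreover have "?G x y * \<bar>f y\<bar> + ?G (- x) y * \<bar>f y\<bar> \<le> (4 * C / pi\<^sup>2) * (?T x y + ?T (- x) y)"
        unfolding distrib_left by (intro add_mono tail) auto
      ultimately show ?thesis by simp
    qed
  next
    show "integrable lebesgue (\<lambda>y. - (4 * C / pi\<^sup>2) * (?T x y + ?T (- x) y))"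
      by (intro integrable_mult_right Bochner_Integration.integrable_add
          normal_second_moment_lebesgue \<sigma>)
  qed (use int in auto)
  also have "(LINT y|lebesgue. - (4 * C / pi\<^sup>2) * (?T x y + ?T (- x) y))
      = - (4 * C / pi\<^sup>2) * (\<sigma>\<^sup>2 + \<sigma>\<^sup>2)"
    by (subst integral_mult_right_zero, subst Bochner_Integration.integral_add)
      (simp_all only: normal_second_moment_lebesgue[OF \<sigma>(1)])
  finally show ?thesis by (simp add: \<sigma>(2))
qed

lemma heat_semigroup_lower_bound:
  assumes \<tau>: "0 < \<tau>" and f: "f \<in> borel_measurable lebesgue" "\<And>x. \<bar>f x\<bar> \<le> C"
    and odd: "odd_fun f" and periodic: "periodic_2pi f"
    and nonneg: "\<And>x. x \<in> {0..pi} \<Longrightarrow> 0 \<le> f x" and x: "x \<in> {0..pi}"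
  shows "- (C * 8 / pi\<^sup>2 * \<tau>) \<le> heat_semigroup \<tau> f x"
proof (cases "x \<le> pi / 2")
  case True
  then show ?thesis
    using x by (intro heat_semigroup_lower_bound_left[OF \<tau> f odd nonneg]) auto
next
  case False
  have "- (C * 8 / pi\<^sup>2 * \<tau>) \<le> heat_semigroup \<tau> (\<lambda>y. f (pi - y)) (pi - x)"
  proof (rule heat_semigroup_lower_bound_left[OF \<tau>])
    have "(\<lambda>y. pi - y) \<in> lebesgue \<rightarrow>\<^sub>M lebesgue"
      using lebesgue_affine_measurable[where c = "\<lambda>_::real. -1" and t = pi] by simp
    then show "(\<lambda>y. f (pi - y)) \<in> borel_measurable lebesgue"
      using f(1) by (rule measurable_compose)
    show "odd_fun (\<lambda>y. f (pi - y))"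
      using odd_fun_reflect_pi[OF odd periodic] by (simp add: odd_fun_def)
  qed (use f nonneg x False in auto)
  then show ?thesis by (simp flip: heat_semigroup_reflect)
qed

lemma normal_density_shift: "normal_density x \<sigma> (x + z) = normal_density 0 \<sigma> z"
  by (simp add: normal_density_def)

lemma integral_window_Lipschitz:
  fixes g :: "real \<Rightarrow> real"
  assumes g: "g \<in> borel_measurable lborel" "\<And>x. \<bar>g x\<bar> \<le> C" and ab: "a \<le> b"
  shows "\<bar>(LINT x|lborel. indicator {a..b} x * g (x + z)) - (LINT x|lborel. indicator {a..b} x * g x)\<bar>
    \<le> 2 * C * \<bar>z\<bar>"
proof -
  have C: "0 \<le> C" using g(2)[of 0] by linarith
  have [simp]: "integrable lborel (indicat_real {c..d})" for c d :: real
    by (rule integrable_real_indicator) (auto simp: emeasure_lborel_Icc_eq)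
  have ind: "integrable lborel (\<lambda>x. indicator {c..d} x * g x)" for c d :: real
    by (rule Bochner_Integration.integrable_bound[where f = "\<lambda>x. C * indicator {c..d} x"])
      (use g C in \<open>auto simp: abs_mult intro!: AE_I2 split: split_indicator\<close>)
  have shift: "(LINT x|lborel. indicator {a..b} x * g (x + z))
      = (LINT x|lborel. indicator {a + z..b + z} x * g x)"
    by (subst lborel_integral_real_affine[where c = 1 and t = z])
      (auto intro!: Bochner_Integration.integral_cong simp: indicator_def add.commute)
  define J where "J = {min a (a + z)..max a (a + z)}"
  define J' where "J' = {min b (b + z)..max b (b + z)}"
  have "\<bar>LINT x|lborel. (indicator {a + z..b + z} x - indicator {a..b} x) * g x\<bar>
      \<le> (LINT x|lborel. C * (indicator J x + indicator J' x))"
  proof (rule abs_integral_le)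
    fix x
    have "\<bar>indicator {a + z..b + z} x - indicator {a..b} x :: real\<bar> \<le> indicator J x + indicator J' x"
      unfolding indicator_def J_def J'_def using ab by (auto simp: min_def max_def)
    then show "\<bar>(indicator {a + z..b + z} x - indicator {a..b} x) * g x\<bar>
        \<le> C * (indicator J x + indicator J' x)"
      unfolding abs_mult using mult_mono[OF _ g(2)[of x]] C
      by (simp add: mult.commute[of C])
  qed (simp add: J_def J'_def)
  also have "\<dots> = 2 * C * \<bar>z\<bar>"
    by (simp add: J_def J'_def min_def max_def)
  finally show ?thesis
    using ind by (simp add: shift left_diff_distrib)
qed

text \<open>Integrating over \<open>x \<in> [a, b]\<close> and exchanging the integrals gives
  \<open>\<integral> G(z) H(z) dz = 0\<close>, where \<open>H(z)\<close> is the integral of \<open>g\<close> over \<open>[a + z, b + z]\<close> and \<open>G\<close> is the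
  Gaussian of variance \<open>\<sigma>\<^sup>2\<close>. As \<open>H\<close> is Lipschitz continuous and the first absolute moment of \<open>G\<close> is of
  order \<open>\<sigma>\<close>, letting \<open>\<sigma> \<rightarrow> 0\<close> yields \<open>H(0) = 0\<close>.\<close>

lemma gaussian_averages_zero_imp_integral_zero:
  fixes g :: "real \<Rightarrow> real"
  assumes g: "g \<in> borel_measurable lborel" "\<And>x. \<bar>g x\<bar> \<le> C" and ab: "a \<le> b"
    and zero: "\<And>\<sigma> x. 0 < \<sigma> \<Longrightarrow> (LINT y|lborel. normal_density x \<sigma> y * g y) = 0"
  shows "(LINT x|lborel. indicator {a..b} x * g x) = 0"
proof -
  have [measurable]: "g \<in> borel_measurable borel" using g(1) by simp
  have C: "0 \<le> C" using g(2)[of 0] by linarith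
  have ind: "integrable lborel (indicat_real {a..b})"
    by (rule integrable_real_indicator) (auto simp: emeasure_lborel_Icc_eq)
  define H where "H z = (LINT x|lborel. indicator {a..b} x * g (x + z))" for z
  have lip: "\<bar>H z - H 0\<bar> \<le> 2 * C * \<bar>z\<bar>" for z
    using integral_window_Lipschitz[OF g ab, of z] by (simp add: H_def)
  have bound: "\<bar>H 0\<bar> \<le> 2 * C * (\<sigma> * sqrt (2 / pi))" if \<sigma>: "0 < \<sigma>" for \<sigma>
  proof -
    let ?G = "normal_density 0 \<sigma>"
    let ?f = "\<lambda>x z. indicator {a..b} x * (?G z * g (x + z))"
    have inner: "integrable lborel (\<lambda>z. ?G z * g (x + z))" for x
      by (rule Bochner_Integration.integrable_bound[where f = "\<lambda>z. C * ?G z"])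
        (use \<sigma> g C in \<open>auto simp: abs_mult mult.commute[of C] intro!: mult_left_mono AE_I2\<close>)
    have "integrable (lborel \<Otimes>\<^sub>M lborel) (case_prod ?f)"
    proof (rule lborel_pair.Fubini_integrable)
      show "integrable lborel (\<lambda>x. LINT z|lborel. norm (case_prod ?f (x, z)))"
      proof (rule Bochner_Integration.integrable_bound[where f = "\<lambda>x. C * indicator {a..b} x"])
        have "(LINT z|lborel. \<bar>?f x z\<bar>) \<le> C * indicator {a..b} x" for x
        proof -
          have "(LINT z|lborel. \<bar>?f x z\<bar>) \<le> (LINT z|lborel. (C * indicator {a..b} x) * ?G z)"
          proof (rule integral_mono)
            show "integrable lborel (\<lambda>z. \<bar>?f x z\<bar>)"
              using inner by simp
            show "\<bar>?f x z\<bar> \<le> (C * indicator {a..b} x) * ?G z" for z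
              using mult_left_mono[OF g(2)[of "x + z"], of "?G z"]
              by (auto simp: abs_mult indicator_def mult_ac)
          qed (use \<sigma> in simp)
          then show ?thesis using \<sigma> by simp
        qed
        then show "AE x in lborel. norm (LINT z|lborel. norm (case_prod ?f (x, z)))
            \<le> norm (C * indicator {a..b} x)"
          using C by (auto intro!: AE_I2)
      qed (use ind in auto)
    qed (use inner in \<open>auto\<close>)
    then have "(LINT z|lborel. LINT x|lborel. ?f x z) = (LINT x|lborel. LINT z|lborel. ?f x z)"
      by (rule lborel_pair.Fubini_integral)
    moreover have "(LINT z|lborel. ?G z * g (x + z)) = 0" for x
    proof -
      have "(LINT y|lborel. normal_density x \<sigma> y * g y) = (LINT z|lborel. ?G z * g (x + z))"
        by (subst lborel_integral_real_affine[where c = 1 and t = x])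
          (simp_all add: normal_density_shift)
      then show ?thesis using zero[OF \<sigma>] by simp
    qed
    moreover have "(LINT x|lborel. ?f x z) = ?G z * H z" for z
      by (simp add: H_def mult.left_commute)
    ultimately have GH: "(LINT z|lborel. ?G z * H z) = 0" by simp
    have Gabs: "integrable lborel (\<lambda>z. ?G z * \<bar>z\<bar>)"
      "(LINT z|lborel. ?G z * \<bar>z\<bar>) = \<sigma> * sqrt (2 / pi)"
      using integrable_normal_moment_abs[OF \<sigma>, of 0 1] integral_normal_moment_abs_odd[OF \<sigma>, of 0 0]
      by simp_all
    have "H \<in> borel_measurable lborel" unfolding H_def by measurable
    then have int: "integrable lborel (\<lambda>z. ?G z * (H 0 - H z))"
    proof (intro Bochner_Integration.integrable_bound[OF integrable_mult_right[OF Gabs(1), of "2 * C"]])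
      show "AE z in lborel. norm (?G z * (H 0 - H z)) \<le> norm (2 * C * (?G z * \<bar>z\<bar>))"
        using C mult_left_mono[OF lip normal_density_nonneg[of 0 \<sigma>]]
        by (intro AE_I2) (simp add: abs_mult abs_minus_commute mult_ac)
    qed auto
    have "H 0 = (LINT z|lborel. ?G z * H 0)" using \<sigma> by simp
    also have "\<dots> = (LINT z|lborel. ?G z * (H 0 - H z)) + (LINT z|lborel. ?G z * H z)"
    proof -
      have "integrable lborel (\<lambda>z. ?G z * H 0 - ?G z * (H 0 - H z))"
        using int \<sigma> by (intro Bochner_Integration.integrable_diff) auto
      then have "integrable lborel (\<lambda>z. ?G z * H z)" by (simp add: right_diff_distrib)
      then show ?thesis
        by (subst Bochner_Integration.integral_add[symmetric, OF int]) (simp_all add: right_diff_distrib)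
    qed
    also have "\<dots> = (LINT z|lborel. ?G z * (H 0 - H z))" using GH by simp
    finally have "\<bar>H 0\<bar> = \<bar>LINT z|lborel. ?G z * (H 0 - H z)\<bar>" by simp
    also have "\<dots> \<le> (LINT z|lborel. 2 * C * (?G z * \<bar>z\<bar>))"
    proof (rule abs_integral_le)
      show "\<bar>?G z * (H 0 - H z)\<bar> \<le> 2 * C * (?G z * \<bar>z\<bar>)" for z
        using mult_left_mono[OF lip[of z] normal_density_nonneg[of 0 \<sigma> z]]
        by (simp add: abs_mult abs_minus_commute mult_ac)
    qed (use Gabs in auto)
    also have "\<dots> = 2 * C * (\<sigma> * sqrt (2 / pi))" using Gabs by simp
    finally show ?thesis .
  qed
  have "((\<lambda>\<sigma>. 2 * C * (\<sigma> * sqrt (2 / pi))) \<longlongrightarrow> 2 * C * (0 * sqrt (2 / pi))) (at_right 0)"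
    by (intro tendsto_intros)
  then have "\<bar>H 0\<bar> \<le> 2 * C * (0 * sqrt (2 / pi))"
    by (rule tendsto_lowerbound) (auto intro!: bound eventually_mono[OF eventually_at_right_less])
  then show ?thesis by (simp add: H_def)
qed

lemma periodic_2pi_of_int:
  assumes "periodic_2pi f"
  shows "f (x + 2 * pi * of_int n) = f x"
proof (induction n rule: int_induct[where k = 0])
  case (step1 i)
  have "f (x + 2 * pi * of_int (i + 1)) = f (x + 2 * pi * of_int i + 2 * pi)"
    by (simp add: algebra_simps)
  then show ?case using assms step1 unfolding periodic_2pi_def by simp
next
  case (step2 i)
  have "f (x + 2 * pi * of_int i) = f (x + 2 * pi * of_int (i - 1) + 2 * pi)"
    by (simp add: algebra_simps)
  then show ?case using assms step2 unfolding periodic_2pi_def by simp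
qed simp

lemma reduce_to_period:
  obtains y n where "y \<in> {-pi..pi}" "x = y + 2 * pi * of_int n"
proof -
  define n where "n = \<lfloor>(x + pi) / (2 * pi)\<rfloor>"
  define y where "y = x - 2 * pi * of_int n"
  have "of_int n \<le> (x + pi) / (2 * pi)" "(x + pi) / (2 * pi) < of_int n + 1"
    unfolding n_def by linarith+
  then have "y \<in> {-pi..pi}"
    by (auto simp: y_def field_simps)
  moreover have "x = y + 2 * pi * of_int n" by (simp add: y_def)
  ultimately show ?thesis by (rule that)
qed

lemma AE_zero_if_zero_on_half_period:
  fixes f :: "real \<Rightarrow> real"
  assumes odd: "odd_fun f" and periodic: "periodic_2pi f"
    and zero: "AE x in lebesgue. x \<in> {0..pi} \<longrightarrow> f x = 0"
  shows "AE x in lebesgue. f x = 0"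
proof -
  define A where "A = {x \<in> {0..pi}. f x \<noteq> 0}"
  have "{x. \<not> (x \<in> {0..pi} \<longrightarrow> f x = 0)} = A" by (auto simp: A_def)
  then have A: "negligible A"
    using zero unfolding eventually_ae_filter_negligible by (metis negligible_subset)
  have "negligible (uminus ` A)"
    using A by (intro negligible_differentiable_image_negligible)
      (auto intro!: differentiable_at_imp_differentiable_on)
  with A have "negligible (A \<union> uminus ` A)" by simp
  then have "negligible ((+) (2 * pi * of_int n) ` (A \<union> uminus ` A))" for n :: int
    by (rule negligible_translation)
  then have neg: "negligible (\<Union>n::int. (+) (2 * pi * of_int n) ` (A \<union> uminus ` A))"
    by (intro negligible_countable_Union) auto
  have "{x. f x \<noteq> 0} \<subseteq> (\<Union>n::int. (+) (2 * pi * of_int n) ` (A \<union> uminus ` A))"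
  proof
    fix x assume "x \<in> {x. f x \<noteq> 0}"
    then have fx: "f x \<noteq> 0" by simp
    obtain y n where y: "y \<in> {-pi..pi}" and n: "x = y + 2 * pi * of_int n"
      by (rule reduce_to_period)
    have "f y \<noteq> 0" using periodic_2pi_of_int[OF periodic, of y n] fx n by simp
    have "y \<in> A \<union> uminus ` A"
    proof (cases "0 \<le> y")
      case True
      then show ?thesis using y \<open>f y \<noteq> 0\<close> by (simp add: A_def)
    next
      case False
      then have "- y \<in> A" using y \<open>f y \<noteq> 0\<close> odd by (simp add: A_def odd_fun_def)
      then have "y \<in> uminus ` A" by force
      then show ?thesis by simp
    qed
    moreover have "x = 2 * pi * of_int n + y" using n by simp
    ultimately show "x \<in> (\<Union>n::int. (+) (2 * pi * of_int n) ` (A \<union> uminus ` A))" by blast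
  qed
  then have "negligible {x. f x \<noteq> 0}" by (rule negligible_subset[OF neg])
  then show ?thesis
    unfolding eventually_ae_filter_negligible by blast
qed

lemma AE_zero_if_heat_semigroup_zero:
  assumes f: "f \<in> borel_measurable lebesgue" "\<And>x. \<bar>f x\<bar> \<le> C"
    and odd: "odd_fun f" and periodic: "periodic_2pi f"
    and nonneg: "\<And>x. x \<in> {0..pi} \<Longrightarrow> 0 \<le> f x"
    and zero: "\<And>\<tau> x. 0 < \<tau> \<Longrightarrow> heat_semigroup \<tau> f x = 0"
  shows "AE x in lebesgue. f x = 0"
proof (rule AE_zero_if_zero_on_half_period[OF odd periodic])
  obtain g0 where g0: "g0 \<in> borel_measurable lborel" "AE x in lborel. f x = g0 x"
    using completion_ex_borel_measurable_real[OF f(1)] by blast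
  \<comment> \<open>Truncation makes the Borel version bounded everywhere, not only almost everywhere.\<close>
  define g where "g x = max (- C) (min C (g0 x))" for x
  have C: "0 \<le> C" using f(2)[of 0] by linarith
  have g: "g \<in> borel_measurable lborel" "\<And>x. \<bar>g x\<bar> \<le> C"
    using g0(1) C by (auto simp: g_def[abs_def] abs_le_iff)
  have "AE x in lebesgue. f x = g0 x" using g0(2) by (rule AE_completion)
  then have fg: "AE x in lebesgue. f x = g x"
  proof (rule AE_mp, intro AE_I2 impI)
    fix x assume "f x = g0 x"
    then show "f x = g x" using f(2)[of x] by (simp add: g_def abs_le_iff)
  qed
  have [measurable]: "g \<in> borel_measurable borel" using g(1) by simp
  have g': "g \<in> borel_measurable lebesgue" using g(1) by (rule measurable_completion)
  have "(LINT y|lborel. normal_density x \<sigma> y * g y) = 0" if \<sigma>: "0 < \<sigma>" for \<sigma> x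
  proof -
    have "(LINT y|lborel. normal_density x \<sigma> y * g y) = (LINT y|lebesgue. normal_density x \<sigma> y * g y)"
      by (intro integral_completion[symmetric]) measurable
    also have "\<dots> = (LINT y|lebesgue. normal_density x \<sigma> y * f y)"
      using fg integrable_normal_density_mult[OF \<sigma> g' g(2)] integrable_normal_density_mult[OF \<sigma> f]
      by (intro integral_cong_AE) (auto dest: borel_measurable_integrable)
    also have "\<dots> = heat_semigroup (\<sigma>\<^sup>2 / 2) f x"
      using \<sigma> by (simp add: heat_semigroup_normal_density)
    also have "\<dots> = 0" using \<sigma> by (intro zero) simp
    finally show ?thesis .
  qed
  from gaussian_averages_zero_imp_integral_zero[OF g _ this, of 0 pi]
  have "(LINT x|lborel. indicator {0..pi} x * g x) = 0" by simp
  moreover have ind: "integrable lborel (\<lambda>x. indicator {0..pi} x * g x)"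
  proof (rule Bochner_Integration.integrable_bound[where f = "\<lambda>x. C * indicator {0..pi} x"])
    show "integrable lborel (\<lambda>x. C * indicator {0..pi} x)"
      by (intro integrable_mult_right integrable_real_indicator) (auto simp: emeasure_lborel_Icc_eq)
  qed (use g C in \<open>auto simp: abs_mult intro!: AE_I2 split: split_indicator\<close>)
  ultimately have "(LINT x|lebesgue. indicator {0..pi} x * g x) = 0"
    and "integrable lebesgue (\<lambda>x. indicator {0..pi} x * g x)"
    using borel_measurable_integrable[OF ind]
    by (simp_all add: integral_completion integrable_completion)
  moreover have "AE x in lebesgue. 0 \<le> indicator {0..pi} x * g x"
    using fg
  proof eventually_elim
    case (elim x)
    then show ?case using nonneg[of x] by (simp split: split_indicator)
  qed
  ultimately have "AE x in lebesgue. indicator {0..pi} x * g x = 0"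
    using integral_nonneg_eq_0_iff_AE by blast
  with fg show "AE x in lebesgue. x \<in> {0..pi} \<longrightarrow> f x = 0"
    by eventually_elim (auto split: split_indicator_asm)
qed

section \<open>Symmetry and sign of the solution\<close>

lemma abs_minus_cube_le:
  fixes v :: real
  assumes "\<bar>v\<bar> \<le> M"
  shows "\<bar>v - v^3\<bar> \<le> M + M^3"
proof -
  have "\<bar>v\<bar>^3 \<le> M^3" using assms by (intro power_mono) auto
  then have "\<bar>v^3\<bar> \<le> M^3" by (simp add: power_abs)
  then show ?thesis using assms by linarith
qed

text \<open>The datum may be discontinuous, so \<open>u(t)\<close> need not converge to it uniformly; but the
  Duhamel formula shows that \<open>u(t)\<close> and the heat flow of the datum agree up to order \<open>t\<close>.\<close>

lemma allen_cahn_near_heat_flow: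
  assumes \<kappa>: "0 < \<kappa>" and u: "allen_cahn_solution \<kappa> u0 u"
  obtains C where "0 \<le> C"
    "\<And>t x. 0 < t \<Longrightarrow> \<bar>u t x - heat_semigroup (\<kappa>\<^sup>2 * t) u0 x\<bar> \<le> C * t"
proof -
  obtain M where M: "\<And>t x. 0 \<le> t \<Longrightarrow> \<bar>u t x\<bar> \<le> M"
    using u unfolding allen_cahn_solution_def by blast
  define C where "C = M + M^3"
  have "0 \<le> M" using M[of 0 0] by simp
  then have C: "0 \<le> C" by (simp add: C_def)
  have "\<bar>u t x - heat_semigroup (\<kappa>\<^sup>2 * t) u0 x\<bar> \<le> C * t" if t: "0 < t" for t x
  proof -
    let ?F = "\<lambda>s. heat_semigroup (\<kappa>\<^sup>2 * (t - s)) (\<lambda>y. u s y - (u s y)^3) x"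
    have "u t x - heat_semigroup (\<kappa>\<^sup>2 * t) u0 x = (LINT s|lebesgue. indicator {0<..<t} s *\<^sub>R ?F s)"
      using u t unfolding allen_cahn_solution_def set_lebesgue_integral_def by simp
    also have "\<bar>\<dots>\<bar> \<le> (LINT s|lebesgue. C * indicator {0<..<t} s)"
    proof (rule abs_integral_le)
      show "integrable lebesgue (\<lambda>s. C * indicator {0<..<t} s)"
        using t by (intro integrable_mult_right integrable_real_indicator) auto
      show "\<bar>indicator {0<..<t} s *\<^sub>R ?F s\<bar> \<le> C * indicator {0<..<t} s" for s
      proof (cases "s \<in> {0<..<t}")
        case True
        then have "\<bar>?F s\<bar> \<le> C"
          using \<kappa> M unfolding C_def by (intro heat_semigroup_bound abs_minus_cube_le) auto
        then show ?thesis using True by simp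
      qed simp
    qed
    also have "\<dots> = C * t" using t by simp
    finally show ?thesis .
  qed
  then show ?thesis using that C by blast
qed

lemma le_if_le_from_small_times:
  fixes a b C t :: real
  assumes t: "0 < t" and le: "\<And>e. 0 < e \<Longrightarrow> e \<le> t \<Longrightarrow> a - C * e * exp (t - e) \<le> b"
  shows "a \<le> b"
proof (rule tendsto_upperbound)
  have "((\<lambda>e. a - C * e * exp (t - e)) \<longlongrightarrow> a - C * 0 * exp (t - 0)) (at_right 0)"
    by (intro tendsto_intros)
  then show "((\<lambda>e. a - C * e * exp (t - e)) \<longlongrightarrow> a) (at_right 0)" by simp
  show "\<forall>\<^sub>F e in at_right 0. a - C * e * exp (t - e) \<le> b"
    using eventually_at_right_less[of 0] eventually_at_right_real[OF t]
    by eventually_elim (auto intro!: le)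
qed simp

text \<open>Both \<open>u(t, x)\<close> and \<open>- u(t, - x)\<close> solve the equation, and for an odd datum they differ by
  \<open>O(t)\<close> as \<open>t \<rightarrow> 0\<close>. Comparing them from a small time \<open>e\<close> on and letting \<open>e \<rightarrow> 0\<close> identifies them.\<close>

lemma allen_cahn_odd:
  assumes \<kappa>: "0 < \<kappa>" and u: "allen_cahn_solution \<kappa> u0 u" and odd: "odd_fun u0"
    and t: "0 < t" and x: "x \<in> {-pi..pi}"
  shows "u t (- x) = - u t x"
proof -
  obtain C where C: "0 \<le> C"
    "\<And>t x. 0 < t \<Longrightarrow> \<bar>u t x - heat_semigroup (\<kappa>\<^sup>2 * t) u0 x\<bar> \<le> C * t"
    using allen_cahn_near_heat_flow[OF \<kappa> u] by blast
  define v where "v t x = - u t (- x)" for t x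
  note du = allen_cahn_solution_derivs[OF u]
  have reflect: "((\<lambda>y. f (- y)) has_real_derivative - D) (at y)"
    if "(f has_real_derivative D) (at (- y))" for f :: "real \<Rightarrow> real" and D y
    using DERIV_chain2[OF that DERIV_minus[OF DERIV_ident]] by simp
  have v: "parabolic_derivs v e
      (\<lambda>t x. - (\<kappa>\<^sup>2 * deriv (deriv (u t)) (- x) + u t (- x) - (u t (- x))^3))
      (\<lambda>t x. - deriv (deriv (u t)) (- x))" if e: "0 < e" for e
    unfolding parabolic_derivs_def
  proof (intro conjI exI[of _ "\<lambda>t x. deriv (u t) (- x)"] allI impI)
    have cu: "continuous_on ({e..} \<times> UNIV) (\<lambda>(t, x). u t x)"
      using allen_cahn_solution_parabolic_derivs[OF u e] by (simp add: parabolic_derivs_def)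
    have "continuous_on ({e..} \<times> UNIV) (\<lambda>p. (fst p, - snd p) :: real \<times> real)"
      by (intro continuous_intros)
    from continuous_on_compose2[OF cu this]
    have "continuous_on ({e..} \<times> UNIV) (\<lambda>p. u (fst p) (- snd p))"
      by (simp add: image_subset_iff)
    then show "continuous_on ({e..} \<times> UNIV) (\<lambda>(t, x). v t x)"
      unfolding v_def split_def by (rule continuous_on_minus)
    fix t x assume "e < t"
    then have t: "0 < t" using e by simp
    show "((\<lambda>s. v s x) has_real_derivative
        - (\<kappa>\<^sup>2 * deriv (deriv (u t)) (- x) + u t (- x) - (u t (- x))^3)) (at t)"
      unfolding v_def by (intro DERIV_minus du(3) t)
    show "(v t has_real_derivative deriv (u t) (- x)) (at x)"
      unfolding v_def using DERIV_minus[OF reflect[OF du(1)[OF t]]] by simp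
    show "((\<lambda>x. deriv (u t) (- x)) has_real_derivative - deriv (deriv (u t)) (- x)) (at x)"
      by (rule reflect[OF du(2)[OF t]])
  qed
  have per: "periodic_2pi (u t)" if "0 < t" for t
    using u that unfolding allen_cahn_solution_def by simp
  have perv: "periodic_2pi (v t)" if "0 < t" for t
    unfolding periodic_2pi_def v_def
  proof
    fix x
    have "u t (- (x + 2 * pi) + 2 * pi) = u t (- (x + 2 * pi))"
      using per[OF that] unfolding periodic_2pi_def by blast
    then show "- u t (- (x + 2 * pi)) = - u t (- x)" by simp
  qed
  have close: "\<bar>u e x - v e x\<bar> \<le> 2 * C * e" if "0 < e" for e x
    using C(2)[OF that, of x] C(2)[OF that, of "- x"] heat_semigroup_odd[OF odd, of "\<kappa>\<^sup>2 * e" x]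
    by (simp add: v_def)
  have le: "v t x - 2 * C * e * exp (t - e) \<le> u t x" if e: "0 < e" "e \<le> t" for e
  proof (rule allen_cahn_comparison_periodic[OF v allen_cahn_solution_parabolic_derivs[OF u],
        where \<kappa> = \<kappa>])
    show "v e x - 2 * C * e \<le> u e x" for x using close[OF e(1), of x] by linarith
  qed (use e C x per perv in \<open>auto simp: v_def\<close>)
  have ge: "u t x - 2 * C * e * exp (t - e) \<le> v t x" if e: "0 < e" "e \<le> t" for e
  proof (rule allen_cahn_comparison_periodic[OF allen_cahn_solution_parabolic_derivs[OF u] v,
        where \<kappa> = \<kappa>])
    show "u e x - 2 * C * e \<le> v e x" for x using close[OF e(1), of x] by linarith
  qed (use e C x per perv in \<open>auto simp: v_def\<close>)
  have "v t x = u t x"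
    using le_if_le_from_small_times[OF t le] le_if_le_from_small_times[OF t ge] by simp
  then show ?thesis by (simp add: v_def)
qed

lemma allen_cahn_Dirichlet:
  assumes \<kappa>: "0 < \<kappa>" and u: "allen_cahn_solution \<kappa> u0 u" and odd: "odd_fun u0" and t: "0 < t"
  shows "u t 0 = 0" "u t pi = 0"
proof -
  show "u t 0 = 0" using allen_cahn_odd[OF \<kappa> u odd t, of 0] by simp
  have "periodic_2pi (u t)"
    using u t unfolding allen_cahn_solution_def by simp
  then have "u t (- pi + 2 * pi) = u t (- pi)" unfolding periodic_2pi_def by blast
  then show "u t pi = 0" using allen_cahn_odd[OF \<kappa> u odd t, of pi] by simp
qed

text \<open>At a small time \<open>e\<close> the solution is at least \<open>- O(e)\<close> on \<open>[0, pi]\<close>; compare with zero from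
  then on and let \<open>e \<rightarrow> 0\<close>.\<close>

lemma allen_cahn_nonneg:
  assumes \<kappa>: "0 < \<kappa>" and u: "allen_cahn_solution \<kappa> u0 u"
    and u0: "u0 \<in> borel_measurable lebesgue" "\<And>x. \<bar>u0 x\<bar> \<le> B"
    and odd: "odd_fun u0" and periodic: "periodic_2pi u0"
    and nonneg: "\<And>x. x \<in> {0..pi} \<Longrightarrow> 0 \<le> u0 x"
    and t: "0 < t" and x: "x \<in> {0..pi}"
  shows "0 \<le> u t x"
proof -
  obtain C where C: "0 \<le> C"
    "\<And>t x. 0 < t \<Longrightarrow> \<bar>u t x - heat_semigroup (\<kappa>\<^sup>2 * t) u0 x\<bar> \<le> C * t"
    using allen_cahn_near_heat_flow[OF \<kappa> u] by blast
  have B: "0 \<le> B" using u0(2)[of 0] by linarith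
  define C' where "C' = B * 8 / pi\<^sup>2 * \<kappa>\<^sup>2 + C"
  have C': "0 \<le> C'" using B C(1) by (simp add: C'_def)
  have "0 - C' * e * exp (t - e) \<le> u t x" if e: "0 < e" "e \<le> t" for e
  proof (rule allen_cahn_comparison_Dirichlet[where v = "\<lambda>_ _. 0" and vt = "\<lambda>_ _. 0"
        and vxx = "\<lambda>_ _. 0" and a = 0 and b = pi and \<kappa> = \<kappa>,
        OF _ allen_cahn_solution_parabolic_derivs[OF u e(1)]])
    show "parabolic_derivs (\<lambda>_ _. 0) e (\<lambda>_ _. 0) (\<lambda>_ _. 0)"
      unfolding parabolic_derivs_def by (auto intro!: exI[of _ "\<lambda>_ _. 0"])
    fix y assume y: "y \<in> {0..pi}"
    have "- (B * 8 / pi\<^sup>2 * (\<kappa>\<^sup>2 * e)) \<le> heat_semigroup (\<kappa>\<^sup>2 * e) u0 y"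
      using \<kappa> e by (intro heat_semigroup_lower_bound[OF _ u0 odd periodic nonneg y]) auto
    then show "0 - C' * e \<le> u e y"
      using C(2)[OF e(1), of y] by (simp add: C'_def algebra_simps)
  qed (use e x C' allen_cahn_Dirichlet[OF \<kappa> u odd] in auto)
  then show ?thesis by (rule le_if_le_from_small_times[OF t])
qed

section \<open>Convergence to the ground state\<close>

lemma ground_state_stationary_profile:
  assumes \<kappa>: "0 < \<kappa>" "\<kappa> < 1" and N: "0 < N" "N < 1" and U: "odd_zero_up_ground_state \<kappa> N U"
  obtains k K where "stationary_profile \<kappa> k K U"
proof -
  have smooth: "C_infinity_on UNIV U" and ode: "\<kappa>\<^sup>2 * deriv (deriv U) x + U x - (U x)^3 = 0"
    and U0: "U 0 = 0" and refl: "x \<in> {pi/2..pi} \<Longrightarrow> U (pi - x) = U x" for x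
    using U unfolding odd_zero_up_ground_state_def by auto
  obtain k K where "0 < k" "0 < K"
    "\<And>x. x \<in> {0..pi} \<Longrightarrow> sin x \<le> k * U x" "\<And>x. x \<in> {0..pi} \<Longrightarrow> U x \<le> K * sin x"
    using ground_state_comparable_to_sin[OF \<kappa>(1) N U] by blast
  then have "stationary_profile \<kappa> k K U"
    using \<kappa> ode U0 refl[of pi] C_infinity_on_UNIV_derivs[OF smooth]
    by unfold_locales auto
  then show ?thesis by (rule that)
qed

text \<open>A solution that is positive somewhere becomes bounded below by a multiple of \<open>sin x\<close>, and then
  it is caught between the two barriers.\<close>

lemma eventual_exponential_squeeze:
  assumes \<kappa>: "0 < \<kappa>" "\<kappa> < 1" and profile: "stationary_profile \<kappa> k K U"
    and u: "allen_cahn_solution \<kappa> u0 u" and odd: "odd_fun u0"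
    and nonneg: "\<And>t x. 0 < t \<Longrightarrow> x \<in> {0..pi} \<Longrightarrow> 0 \<le> u t x"
    and t1: "0 < t1" and x1: "x1 \<in> {0..pi}" and pos: "u t1 x1 \<noteq> 0"
  obtains t2 B c where "0 < t2" "0 < B" "0 < c"
    "\<And>t x. t2 \<le> t \<Longrightarrow> x \<in> {0..pi} \<Longrightarrow> \<bar>u t x - U x\<bar> \<le> B * exp (- c * (t - t2))"
proof -
  interpret stationary_profile \<kappa> k K U by (rule profile)
  note ends = allen_cahn_Dirichlet[OF \<kappa>(1) u odd]
  note du = allen_cahn_solution_derivs[OF u]
  have x1': "0 < x1" "x1 < pi" "0 < u t1 x1"
    using x1 pos ends[OF t1] nonneg[OF t1 x1] by (auto simp: less_le)
  obtain t2 e where t2: "t1 \<le> t2" and e: "0 < e" "\<And>x. x \<in> {0..pi} \<Longrightarrow> e * sin x \<le> u t2 x"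
    by (rule positivity_spreads[OF \<kappa>(1) allen_cahn_solution_parabolic_derivs[OF u t1] _ _ x1'])
      (use nonneg t1 in auto)
  have t2': "0 < t2" using t1 t2 by simp
  note parabolic = allen_cahn_solution_parabolic_derivs[OF u t2']
  obtain B1 \<nu> where lower: "0 < B1" "0 < \<nu>"
    "\<And>t x. t2 \<le> t \<Longrightarrow> x \<in> {0..pi} \<Longrightarrow> (1 - B1 * exp (- \<nu> * (t - t2))) * U x \<le> u t x"
    by (rule lower_barrier[OF parabolic _ _ _ e]) (use ends t2' in auto)
  obtain A where A: "0 < A" "\<And>x. x \<in> {0..pi} \<Longrightarrow> \<bar>u t2 x\<bar> \<le> A * sin x"
  proof (rule abs_le_sin_if_zero_at_ends[OF du(1)[OF t2'] _ ends[OF t2']])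
    show "continuous_on {0..pi} (deriv (u t2))"
      using du(2)[OF t2'] by (blast intro: DERIV_continuous_on has_field_derivative_at_within)
  qed blast
  have A': "u t2 x \<le> A * sin x" if "x \<in> {0..pi}" for x
    using A(2)[OF that] by simp
  obtain B2 c where upper: "0 < B2" "0 < c"
    "\<And>t x. t2 \<le> t \<Longrightarrow> x \<in> {0..pi} \<Longrightarrow> u t x \<le> (1 + B2 * exp (- c * (t - t2))) * U x"
    by (rule upper_barrier[OF parabolic _ _ _ A(1) A']) (use ends t2' in auto)
  define r where "r = min \<nu> c"
  have r: "0 < r" using lower(2) upper(2) by (simp add: r_def)
  have "\<bar>u t x - U x\<bar> \<le> (B1 + B2) * K * exp (- r * (t - t2))" if t: "t2 \<le> t" and x: "x \<in> {0..pi}" for t x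
  proof -
    let ?E = "exp (- r * (t - t2))"
    have "r * (t - t2) \<le> \<nu> * (t - t2)" "r * (t - t2) \<le> c * (t - t2)"
      using t by (auto simp: r_def intro!: mult_right_mono)
    then have "B1 * exp (- \<nu> * (t - t2)) \<le> B1 * ?E" "B2 * exp (- c * (t - t2)) \<le> B2 * ?E"
      using lower(1) upper(1) by (intro mult_left_mono; simp)+
    moreover have "0 \<le> B1 * ?E" "0 \<le> B2 * ?E"
      using lower(1) upper(1) by simp_all
    ultimately have dom: "B1 * exp (- \<nu> * (t - t2)) \<le> (B1 + B2) * ?E"
      "B2 * exp (- c * (t - t2)) \<le> (B1 + B2) * ?E"
      by (simp_all add: distrib_right)
    have "\<bar>u t x - U x\<bar> \<le> (B1 + B2) * ?E * U x"
      using lower(3)[OF t x] upper(3)[OF t x] mult_right_mono[OF dom(1) U_nonneg[OF x]]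
        mult_right_mono[OF dom(2) U_nonneg[OF x]]
      by (simp add: abs_le_iff left_diff_distrib distrib_right)
    also have "\<dots> \<le> (B1 + B2) * ?E * K"
    proof (rule mult_left_mono)
      have "K * sin x \<le> K * 1" using K by (intro mult_left_mono) auto
      then show "U x \<le> K" using le_sin[OF x] by simp
    qed (use lower(1) upper(1) in simp)
    finally show ?thesis by (simp add: mult_ac)
  qed
  moreover have "0 < (B1 + B2) * K" using lower(1) upper(1) K by simp
  ultimately show ?thesis using that[OF t2' _ r] by blast
qed

text \<open>Symmetry carries the estimate from \<open>[0, pi]\<close> to the whole line, and boundedness carries it back
  to earlier times at the cost of a larger constant.\<close>

lemma exponential_convergence:
  assumes \<kappa>: "0 < \<kappa>" "\<kappa> < 1" and profile: "stationary_profile \<kappa> k K U"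
    and U: "odd_fun U" "periodic_2pi U"
    and u: "allen_cahn_solution \<kappa> u0 u" and odd: "odd_fun u0"
    and nonneg: "\<And>t x. 0 < t \<Longrightarrow> x \<in> {0..pi} \<Longrightarrow> 0 \<le> u t x"
    and t1: "0 < t1" and x1: "x1 \<in> {0..pi}" and pos: "u t1 x1 \<noteq> 0"
  obtains C c where "0 < C" "0 < c" "\<And>t x. 1 \<le> t \<Longrightarrow> \<bar>u t x - U x\<bar> \<le> C * exp (- c * t)"
proof -
  interpret stationary_profile \<kappa> k K U by (rule profile)
  obtain t2 B c where t2: "0 < t2" and B: "0 < B" and c: "0 < c"
    and squeeze: "\<And>t x. t2 \<le> t \<Longrightarrow> x \<in> {0..pi} \<Longrightarrow> \<bar>u t x - U x\<bar> \<le> B * exp (- c * (t - t2))"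
    using eventual_exponential_squeeze[OF \<kappa> profile u odd nonneg t1 x1 pos] by blast
  obtain M where M: "\<And>t x. 0 \<le> t \<Longrightarrow> \<bar>u t x\<bar> \<le> M"
    using u unfolding allen_cahn_solution_def by blast
  have M0: "0 \<le> M" using M[of 0 0] by simp
  define C where "C = (B + M + K) * exp (c * t2)"
  have C: "0 < C" using B M0 K by (simp add: C_def add_pos_nonneg)
  have main: "\<bar>u t x - U x\<bar> \<le> C * exp (- c * t)" if t: "0 < t" and x: "x \<in> {0..pi}" for t x
  proof -
    have shift: "C * exp (- c * t) = (B + M + K) * exp (- c * (t - t2))"
      by (simp add: C_def algebra_simps flip: exp_add)
    show ?thesis
    proof (cases "t2 \<le> t")
      case True
      have "B * exp (- c * (t - t2)) \<le> (B + M + K) * exp (- c * (t - t2))"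
        using M0 K by (intro mult_right_mono) auto
      then show ?thesis using squeeze[OF True x] shift by linarith
    next
      case False
      have "K * sin x \<le> K * 1" using K by (intro mult_left_mono) auto
      then have "\<bar>U x\<bar> \<le> K" using le_sin[OF x] U_nonneg[OF x] by simp
      then have "\<bar>u t x - U x\<bar> \<le> B + M + K"
        using M[of t x] t B by simp
      also have "\<dots> \<le> (B + M + K) * exp (- c * (t - t2))"
      proof -
        have "0 \<le> - c * (t - t2)"
          using c False mult_nonneg_nonneg[of c "t2 - t"] by (simp add: algebra_simps)
        then have "(B + M + K) * 1 \<le> (B + M + K) * exp (- c * (t - t2))"
          using B M0 K by (intro mult_left_mono) auto
        then show ?thesis by simp
      qed
      finally show ?thesis using shift by simp
    qed
  qed
  have "\<bar>u t x - U x\<bar> \<le> C * exp (- c * t)" if t: "1 \<le> t" for t x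
  proof -
    have t0: "0 < t" using t by simp
    have per: "periodic_2pi (u t)"
      using u t0 unfolding allen_cahn_solution_def by simp
    obtain y n where y: "y \<in> {-pi..pi}" and x: "x = y + 2 * pi * of_int n"
      by (rule reduce_to_period)
    have eq: "u t x - U x = u t y - U y"
      unfolding x by (simp add: periodic_2pi_of_int[OF per] periodic_2pi_of_int[OF U(2)])
    show ?thesis
    proof (cases "0 \<le> y")
      case True
      then show ?thesis using main[OF t0, of y] y eq by simp
    next
      case False
      have "u t (- y) - U (- y) = - (u t y - U y)"
        using allen_cahn_odd[OF \<kappa>(1) u odd t0 y] U(1) by (simp add: odd_fun_def)
      then show ?thesis using main[OF t0, of "- y"] y False eq by (simp add: abs_minus_commute)
    qed
  qed
  then show ?thesis using that C c by blast
qed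

lemma uniform_limit_if_exponential:
  fixes u :: "real \<Rightarrow> 'a \<Rightarrow> real"
  assumes c: "0 < c" and le: "\<And>t x. 1 \<le> t \<Longrightarrow> \<bar>u t x - U x\<bar> \<le> C * exp (- c * t)"
  shows "uniform_limit S u U at_top"
proof (rule uniform_limitI)
  fix e :: real assume e: "0 < e"
  have "filterlim (\<lambda>t. c * t) at_top at_top"
    using c by (intro filterlim_tendsto_pos_mult_at_top[OF tendsto_const _ filterlim_ident])
  then have "((\<lambda>t. exp (- (c * t))) \<longlongrightarrow> 0) at_top"
    by (intro filterlim_compose[OF exp_at_bot] filterlim_compose[OF filterlim_uminus_at_bot_at_top])
  from tendsto_mult_left[OF this, of C]
  have "\<forall>\<^sub>F t in at_top. C * exp (- (c * t)) < e"
    using e by (intro order_tendstoD(2)) auto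
  then show "\<forall>\<^sub>F t in at_top. \<forall>x\<in>S. dist (u t x) (U x) < e"
    using eventually_ge_at_top[of 1]
  proof eventually_elim
    case (elim t)
    show ?case using le[OF elim(2)] elim(1) by (fastforce simp: dist_real_def intro: le_less_trans)
  qed
qed

theorem theorem1p4:
  fixes \<kappa> N :: real and U u0 :: "real \<Rightarrow> real" and u :: "real \<Rightarrow> real \<Rightarrow> real"
  assumes "0 < \<kappa>" and "\<kappa> < 1"
    and "ground_state_amplitude \<kappa> N"
    and "odd_zero_up_ground_state \<kappa> N U"
    and "u0 \<in> borel_measurable lebesgue"
    and "bounded (range u0)"
    and "periodic_2pi u0"
    and "odd_fun u0"
    and "\<forall>x\<in>{0..pi}. 0 \<le> u0 x"
    and "allen_cahn_solution \<kappa> u0 u"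
  shows "(uniform_limit {-pi..pi} u U at_top \<or> uniform_limit {-pi..pi} u (\<lambda>_. 0) at_top) \<and>
    (\<not> (AE x in lebesgue. u0 x = 0) \<and> H1_torus u0 \<and> energy \<kappa> u0 \<le> pi / 2 \<longrightarrow>
       uniform_limit {-pi..pi} u U at_top \<and>
       (\<exists>C>0. \<exists>c>0. \<forall>t\<ge>1. \<forall>x. \<bar>u t x - U x\<bar> \<le> C * exp (- c * t)))"
proof -
  note \<kappa> = assms(1,2) and u = assms(10) and odd = assms(8)
  obtain B where B: "\<And>x. \<bar>u0 x\<bar> \<le> B"
    using assms(6) unfolding bounded_iff by auto
  have u0_nonneg: "x \<in> {0..pi} \<Longrightarrow> 0 \<le> u0 x" for x using assms(9) by blast
  have nonneg: "0 \<le> u t x" if "0 < t" "x \<in> {0..pi}" for t x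
    by (rule allen_cahn_nonneg[OF \<kappa>(1) u assms(5) B odd assms(7) u0_nonneg that])
  have U: "odd_fun U" "periodic_2pi U"
    using assms(4) by (simp_all add: odd_zero_up_ground_state_def)
  obtain k K where profile: "stationary_profile \<kappa> k K U"
    using ground_state_stationary_profile[OF \<kappa> _ _ assms(4)] assms(3)
    unfolding ground_state_amplitude_def by blast
  show ?thesis
  proof (cases "\<exists>t1>0. \<exists>x1\<in>{0..pi}. u t1 x1 \<noteq> 0")
    case True
    then obtain C c where C: "0 < C" "0 < c"
      "\<And>t x. 1 \<le> t \<Longrightarrow> \<bar>u t x - U x\<bar> \<le> C * exp (- c * t)"
      using exponential_convergence[OF \<kappa> profile U u odd nonneg] by metis
    have "uniform_limit {-pi..pi} u U at_top"
      by (rule uniform_limit_if_exponential[OF C(2)]) (rule C(3))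
    then show ?thesis using C by blast
  next
    case False
    have zero: "u t x = 0" if t: "0 < t" for t x
    proof -
      have per: "periodic_2pi (u t)"
        using u t unfolding allen_cahn_solution_def by simp
      obtain y n where y: "y \<in> {-pi..pi}" and x: "x = y + 2 * pi * of_int n"
        by (rule reduce_to_period)
      have "u t y = 0"
        using False t y allen_cahn_odd[OF \<kappa>(1) u odd t y]
        by (cases "0 \<le> y") (fastforce dest: spec[of _ t])+
      then show ?thesis unfolding x by (simp add: periodic_2pi_of_int[OF per])
    qed
    have "\<forall>\<^sub>F t::real in at_top. \<forall>x\<in>{-pi..pi}. dist (u t x) 0 < e" if "0 < e" for e
      using eventually_gt_at_top[of 0] by eventually_elim (use zero that in auto)
    then have "uniform_limit {-pi..pi} u (\<lambda>_. 0) at_top"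
      by (intro uniform_limitI)
    moreover have "AE x in lebesgue. u0 x = 0"
    proof (rule AE_zero_if_heat_semigroup_zero[OF assms(5) B odd assms(7) u0_nonneg])
      fix \<tau> x :: real assume \<tau>: "0 < \<tau>"
      define t where "t = \<tau> / \<kappa>\<^sup>2"
      have t: "0 < t" "\<kappa>\<^sup>2 * t = \<tau>" using \<tau> \<kappa> by (auto simp: t_def)
      \<comment> \<open>The Duhamel integral vanishes together with \<open>u\<close>.\<close>
      have "heat_semigroup s (\<lambda>y. u r y - (u r y)^3) x = 0" if "r \<in> {0<..<t}" for s r
        using zero that by (simp add: heat_semigroup_def)
      then have "(LINT s:{0<..<t}|lebesgue.
          heat_semigroup (\<kappa>\<^sup>2 * (t - s)) (\<lambda>y. u s y - (u s y)^3) x) = 0"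
        unfolding set_lebesgue_integral_def by (intro integral_eq_zero_AE AE_I2) (auto split: split_indicator)
      moreover have "u t x = heat_semigroup (\<kappa>\<^sup>2 * t) u0 x + (LINT s:{0<..<t}|lebesgue.
          heat_semigroup (\<kappa>\<^sup>2 * (t - s)) (\<lambda>y. u s y - (u s y)^3) x)"
        using u t(1) unfolding allen_cahn_solution_def by blast
      ultimately show "heat_semigroup \<tau> u0 x = 0"
        using zero[OF t(1)] t(2) by simp
    qed
    ultimately show ?thesis by blast
  qed
qed

end
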